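(* Let $\mathfrak{h}$ be a $d$-dimensional complex vector space with a nondegenerate symmetric bilinear form, let $h\in\mathfrak{h}$, and let $G=\mathrm{Aut}(V_{\widehat{\mathfrak{h}}}(1,0),\omega_h)$ be the automorphism group of the vertex operator algebra $(V_{\widehat{\mathfrak{h}}}(1,0),\omega_h)$. Then: 1) There is an order preserving $G$-equivariant bijection $\mathrm{Sc}(V_{\widehat{\mathfrak{h}}}(1,0),\omega_h)\cong\mathrm{Reg}(\mathfrak{h})_h$. 2) There exists a longest chain in $\mathrm{Sc}(V_{\widehat{\mathfrak{h}}}(1,0),\omega_h)$ whose length equals $d$: there exist $\omega^1,\dots,\omega^{d-1}\in\mathrm{Sc}(V_{\widehat{\mathfrak{h}}}(1,0),\omega_h)$ such that $$0=\omega^0\prec\omega^1\prec\cdots\prec\omega^{d-1}\prec\omega^d=\omega_h .$$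
   Context: Everything is over $\mathbb{C}$. $\widehat{\mathfrak{h}}=\mathbb{C}[t,t^{-1}]\otimes\mathfrak{h}\oplus\mathbb{C}C$ is the Lie algebra with $C$ central and $[u\otimes t^m,v\otimes t^n]=m\langle u,v\rangle\delta_{m,-n}C$. $V_{\widehat{\mathfrak{h}}}(1,0)=U(\widehat{\mathfrak{h}})\otimes_{U(\widehat{\mathfrak{h}}^{\geq 0})}\mathbb{C}\mathbf{1}$, where $\widehat{\mathfrak{h}}^{\ge 0}=\mathbb{C}[t]\otimes\mathfrak{h}\oplus\mathbb{C}C$ acts on $\mathbb{C}\mathbf{1}$ with $\mathbb{C}[t]\otimes\mathfrak{h}$ acting by $0$ and $C$ by $1$. Write $u(n)$ for the action of $u\otimes t^n$. It has a unique vertex algebra structure with vacuum $\mathbf{1}$ and $Y(u(-1)\mathbf{1},z)=\sum_{n}u(n)z^{-n-1}$. $\mathfrak{h}$ is identified with the weight-one subspace via $u\mapsto u(-1)\mathbf{1}$. For an orthonormal basis $h_1,\dots,h_d$ of $\mathfrak{h}$, $\omega_h=\frac12\sum_i h_i(-1)^2\mathbf{1}+h(-2)\mathbf{1}$, a conformal vector. Semi-conformal vectors: for a vertex operator algebra $(V,\omega)$, with $Y(v,z)=\sum_n v_nz^{-n-1}$, a vector $\omega'\in V$ is semi-conformal if it is the conformal vector of a vertex operator subalgebra $U$ of $V$ (possibly with $\omega'\ne\omega$, same vacuum) such that $\omega_n|_U=\omega'_n|_U$ for all $n\ge0$. $\mathrm{Sc}(V,\omega)$ is the set of semi-conformal vectors.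 Partial order: for $\omega^1,\omega^2\in\mathrm{Sc}(V,\omega)$ put $L^i(n)=(\omega^i)_{n+1}$; $\omega^1\preceq\omega^2$ if and only if $L^2(0)\omega^1=2\omega^1$, $L^2(1)\omega^1=0$, $L^2(2)\omega^1=L^1(2)\omega^1$, $L^2(-1)\omega^1=L^1(-1)\omega^1$, and $L^2(n)\omega^1=0$ for all $n\ge3$. $\prec$ means $\preceq$ and $\ne$. A subspace $\mathfrak{h}'\subseteq\mathfrak{h}$ (possibly $0$) is regular if the form restricted to $\mathfrak{h}'$ is nondegenerate; then $\mathfrak{h}=\mathfrak{h}'\oplus\mathfrak{h}'^{\perp}$ and $P_{\mathfrak{h}'}:\mathfrak{h}\to\mathfrak{h}'$ is the projection. $\mathrm{Reg}(\mathfrak{h})_h=\{(\mathfrak{h}',h')\mid\mathfrak{h}'\text{ regular},\ h'=P_{\mathfrak{h}'}(h)\}$, partially ordered by $(\mathfrak{h}',h')\le(\mathfrak{h}'',h'')$ iff $\mathfrak{h}'\subseteq\mathfrak{h}''$ and $P_{\mathfrak{h}''}(h')=h'=P_{\mathfrak{h}'}(h'')$. $G$ (vertex algebra automorphisms fixing $\omega_h$) acts on $\mathrm{Sc}$ by $\omega'\mapsto\sigma(\omega')$ and on $\mathrm{Reg}(\mathfrak{h})_h$ by $(\mathfrak{h}',h')\mapsto(\sigma(\mathfrak{h}'),\sigma(h'))$. The length of a chain $\omega^0\prec\cdots\prec\omega^m$ is $m$. *)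

theory Defs
  imports Complex_Main "HOL-Library.Poly_Mapping" "HOL-Library.Product_Plus"
begin

section \<open>Complex vector spaces and quadratic spaces\<close>

class complex_vector = ab_group_add +
  fixes scaleC :: "complex \<Rightarrow> 'a \<Rightarrow> 'a"  (infixr \<open>*C\<close> 75)
  assumes scaleC_add_right: "a *C (x + y) = a *C x + a *C y"
    and scaleC_add_left: "(a + b) *C x = a *C x + b *C x"
    and scaleC_scaleC: "a *C b *C x = (a * b) *C x"
    and scaleC_one: "1 *C x = x"

global_interpretation cvec: vector_space "scaleC :: complex \<Rightarrow> 'a \<Rightarrow> 'a::complex_vector"
  by unfold_locales
    (simp_all add: scaleC_add_right scaleC_add_left scaleC_scaleC scaleC_one)

instantiation complex :: complex_vector
begin

definition scaleC_complex :: "complex \<Rightarrow> complex \<Rightarrow> complex" where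
  "scaleC_complex c x = c * x"

instance
  by standard (simp_all add: scaleC_complex_def algebra_simps)

end

instantiation prod :: (complex_vector, complex_vector) complex_vector
begin

definition scaleC_prod :: "complex \<Rightarrow> 'a \<times> 'b \<Rightarrow> 'a \<times> 'b" where
  "scaleC_prod c x = (c *C fst x, c *C snd x)"

instance
  by standard
    (simp_all add: scaleC_prod_def scaleC_add_right scaleC_add_left scaleC_scaleC scaleC_one)

end

instantiation poly_mapping :: (type, complex_vector) complex_vector
begin

definition scaleC_poly_mapping ::
    "complex \<Rightarrow> ('a \<Rightarrow>\<^sub>0 'b) \<Rightarrow> ('a \<Rightarrow>\<^sub>0 'b)" where
  "scaleC_poly_mapping c f = Poly_Mapping.map (scaleC c) f"

lemma lookup_scaleC: "Poly_Mapping.lookup (c *C f) k = c *C Poly_Mapping.lookup f k"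
  for f :: "'a \<Rightarrow>\<^sub>0 'b"
  by (simp add: scaleC_poly_mapping_def map.rep_eq when_def)

instance
  by standard
    (auto intro!: poly_mapping_eqI simp: lookup_scaleC lookup_add
      scaleC_add_right scaleC_add_left scaleC_scaleC scaleC_one)

end

class complex_quadratic_space = complex_vector +
  fixes form :: "'a \<Rightarrow> 'a \<Rightarrow> complex"
  assumes form_add_left: "form (x + y) z = form x z + form y z"
    and form_scaleC_left: "form (c *C x) y = c * form x y"
    and form_sym: "form x y = form y x"
    and form_nondegenerate: "(\<And>y. form x y = 0) \<Longrightarrow> x = 0"
    and finite_dimensional: "\<exists>B. finite B \<and> (\<forall>x. \<exists>c. x = (\<Sum>b\<in>B. c b *C b))"

definition orthonormal_basis :: "'a::complex_quadratic_space set \<Rightarrow> bool" where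
  "orthonormal_basis B \<longleftrightarrow>
     cvec.independent B \<and> cvec.span B = UNIV \<and>
     (\<forall>a\<in>B. \<forall>b\<in>B. form a b = (if a = b then 1 else 0))"

definition regular_subspace :: "'a::complex_quadratic_space set \<Rightarrow> bool" where
  "regular_subspace S \<longleftrightarrow>
     cvec.subspace S \<and> (\<forall>x\<in>S. (\<forall>y\<in>S. form x y = 0) \<longrightarrow> x = 0)"

text \<open>The projection onto \<open>S\<close> along its orthogonal complement, for regular \<open>S\<close>.\<close>

definition proj :: "'a::complex_quadratic_space set \<Rightarrow> 'a \<Rightarrow> 'a" where
  "proj S x = (THE p. p \<in> S \<and> (\<forall>y\<in>S. form (x - p) y = 0))"

definition Reg :: "'a::complex_quadratic_space \<Rightarrow> ('a set \<times> 'a) set" where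
  "Reg h = {(S, a). regular_subspace S \<and> a = proj S h}"

definition Reg_le :: "'a::complex_quadratic_space set \<times> 'a \<Rightarrow> 'a set \<times> 'a \<Rightarrow> bool" where
  "Reg_le = (\<lambda>(S, a) (T, b). S \<subseteq> T \<and> proj T a = a \<and> a = proj S b)"


section \<open>Vertex algebras\<close>

text \<open>
  \<open>Y u n v\<close> is the mode product \<open>u\<^sub>n v\<close>, i.e. the coefficient of \<open>z\<close> to the power
  \<open>-n-1\<close> in \<open>Y(u,z)v\<close>. The last axiom is the Borcherds identity, the component form of
  the Jacobi identity; by truncation its sums have finitely many nonzero terms.
\<close>

locale vertex_algebra =
  fixes Y :: "'v::complex_vector \<Rightarrow> int \<Rightarrow> 'v \<Rightarrow> 'v"
    and vac :: 'v
  assumes Y_linear_left: "Vector_Spaces.linear scaleC scaleC (\<lambda>u. Y u n v)"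
    and Y_linear_right: "Vector_Spaces.linear scaleC scaleC (Y u n)"
    and truncation: "\<exists>N. \<forall>n\<ge>N. Y u n v = 0"
    and vacuum: "Y vac n v = (if n = -1 then v else 0)"
    and creation: "n \<ge> 0 \<Longrightarrow> Y v n vac = 0" "Y v (-1) vac = v"
    and borcherds:
      "Sum_any (\<lambda>i::nat. (of_int m gchoose i) *C Y (Y u (l + int i) v) (m + n - int i) w) =
       Sum_any (\<lambda>i::nat. ((-1) ^ i * (of_int l gchoose i)) *C
         (Y u (l + m - int i) (Y v (n + int i) w)
           - ((-1) powi l) *C Y v (l + n - int i) (Y u (m + int i) w)))"

definition Vir :: "('v \<Rightarrow> int \<Rightarrow> 'v \<Rightarrow> 'v) \<Rightarrow> 'v \<Rightarrow> int \<Rightarrow> 'v \<Rightarrow> 'v" where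
  "Vir Y w n = Y w (n + 1)"

text \<open>
  \<open>U\<close> is a vertex subalgebra (with the vacuum of the ambient vertex algebra) which is a vertex
  operator algebra with conformal vector \<open>w\<close>: Virasoro relations for some central charge,
  the \<open>L(-1)\<close>-derivative property, and an integral \<open>L(0)\<close>-grading with finite-dimensional
  homogeneous subspaces that vanish in sufficiently negative degrees.
\<close>

definition vertex_operator_subalgebra ::
    "('v::complex_vector \<Rightarrow> int \<Rightarrow> 'v \<Rightarrow> 'v) \<Rightarrow> 'v \<Rightarrow> 'v set \<Rightarrow> 'v \<Rightarrow> bool" where
  "vertex_operator_subalgebra Y vac U w \<longleftrightarrow>
     cvec.subspace U \<and> vac \<in> U \<and> (\<forall>u\<in>U. \<forall>v\<in>U. \<forall>n. Y u n v \<in> U) \<and>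
     w \<in> U \<and>
     (\<exists>c::complex. \<forall>m n. \<forall>v\<in>U.
        Vir Y w m (Vir Y w n v) - Vir Y w n (Vir Y w m v) =
        of_int (m - n) *C Vir Y w (m + n) v
        + (if m + n = 0 then (of_int (m ^ 3 - m) / 12 * c) *C v else 0)) \<and>
     (\<forall>u\<in>U. \<forall>v\<in>U. \<forall>n. Y (Vir Y w (-1) u) n v = - (of_int n *C Y u (n - 1) v)) \<and>
     U = cvec.span (\<Union>k::int. {v\<in>U. Vir Y w 0 v = of_int k *C v}) \<and>
     (\<forall>k::int. \<exists>B. finite B \<and> cvec.span B = {v\<in>U. Vir Y w 0 v = of_int k *C v}) \<and>
     (\<exists>N::int. \<forall>k<N. {v\<in>U. Vir Y w 0 v = of_int k *C v} = {0})"

definition Sc ::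
    "('v::complex_vector \<Rightarrow> int \<Rightarrow> 'v \<Rightarrow> 'v) \<Rightarrow> 'v \<Rightarrow> 'v \<Rightarrow> 'v set" where
  "Sc Y vac w = {w'. \<exists>U. vertex_operator_subalgebra Y vac U w' \<and>
                      (\<forall>n\<ge>0. \<forall>v\<in>U. Y w n v = Y w' n v)}"

definition Sc_le ::
    "('v::complex_vector \<Rightarrow> int \<Rightarrow> 'v \<Rightarrow> 'v) \<Rightarrow> 'v \<Rightarrow> 'v \<Rightarrow> bool" where
  "Sc_le Y w1 w2 \<longleftrightarrow>
     Vir Y w2 0 w1 = 2 *C w1 \<and>
     Vir Y w2 1 w1 = 0 \<and>
     Vir Y w2 2 w1 = Vir Y w1 2 w1 \<and>
     Vir Y w2 (-1) w1 = Vir Y w1 (-1) w1 \<and>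
     (\<forall>n\<ge>3. Vir Y w2 n w1 = 0)"

definition Sc_less ::
    "('v::complex_vector \<Rightarrow> int \<Rightarrow> 'v \<Rightarrow> 'v) \<Rightarrow> 'v \<Rightarrow> 'v \<Rightarrow> bool" where
  "Sc_less Y w1 w2 \<longleftrightarrow> Sc_le Y w1 w2 \<and> w1 \<noteq> w2"

definition Aut ::
    "('v::complex_vector \<Rightarrow> int \<Rightarrow> 'v \<Rightarrow> 'v) \<Rightarrow> 'v \<Rightarrow> 'v \<Rightarrow> ('v \<Rightarrow> 'v) set" where
  "Aut Y vac w = {\<sigma>. Vector_Spaces.linear scaleC scaleC \<sigma> \<and> bij \<sigma> \<and> \<sigma> vac = vac \<and>
                    (\<forall>u n v. \<sigma> (Y u n v) = Y (\<sigma> u) n (\<sigma> v)) \<and> \<sigma> w = w}"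


section \<open>The affinization and its induced module\<close>

text \<open>
  An element \<open>(f, c)\<close> stands for the sum of all \<open>t\<^sup>n \<otimes> f n\<close> plus \<open>c\<close> times the central element.
\<close>

type_synonym 'a affine = "(int \<Rightarrow>\<^sub>0 'a) \<times> complex"

definition bracket :: "'a::complex_quadratic_space affine \<Rightarrow> 'a affine \<Rightarrow> 'a affine" where
  "bracket x y =
     (0, \<Sum>m\<in>Poly_Mapping.keys (fst x).
           of_int m * form (Poly_Mapping.lookup (fst x) m) (Poly_Mapping.lookup (fst y) (- m)))"

definition affine_nonneg :: "'a::complex_quadratic_space affine set" where
  "affine_nonneg = {x. \<forall>n<0. Poly_Mapping.lookup (fst x) n = 0}"

definition word :: "'a affine list \<Rightarrow> ('a affine list \<Rightarrow>\<^sub>0 complex)" where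
  "word w = Poly_Mapping.single w 1"

text \<open>
  The induced module is presented as the free vector space on words modulo relations, the word
  \<open>[x1, ..., xk]\<close> standing for \<open>x1 \<cdots> xk \<otimes> 1\<close>. The first three families
  cut the free algebra on the underlying set of the affinization down to its universal
  enveloping algebra. The fourth is tensoring over the nonnegative part with the
  one-dimensional module on which \<open>(f, c)\<close> acts by the scalar \<open>c\<close>.
\<close>

definition heis_relations ::
    "('a::complex_quadratic_space affine list \<Rightarrow>\<^sub>0 complex) set" where
  "heis_relations =
     {word (p @ [x + y] @ q) - word (p @ [x] @ q) - word (p @ [y] @ q) | p x y q. True} \<union>
     {word (p @ [c *C x] @ q) - c *C word (p @ [x] @ q) | p c x q. True} \<union>
     {word (p @ [x, y] @ q) - word (p @ [y, x] @ q) - word (p @ [bracket x y] @ q)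
        | p x y q. True} \<union>
     {word (p @ [x]) - snd x *C word p | p x. x \<in> affine_nonneg}"

definition heis_eq ::
    "('a::complex_quadratic_space affine list \<Rightarrow>\<^sub>0 complex) \<Rightarrow>
     ('a affine list \<Rightarrow>\<^sub>0 complex) \<Rightarrow> bool" where
  "heis_eq f g \<longleftrightarrow> f - g \<in> cvec.span heis_relations"

lemma equivp_heis_eq: "equivp heis_eq"
proof (rule equivpI)
  show "reflp heis_eq"
    by (simp add: reflp_def heis_eq_def cvec.span_zero)
  show "symp heis_eq"
    by (rule sympI) (use cvec.span_neg in \<open>force simp: heis_eq_def\<close>)
  show "transp heis_eq"
    by (rule transpI) (use cvec.span_add in \<open>force simp: heis_eq_def\<close>)
qed

quotient_type (overloaded) 'a heis =
    "'a::complex_quadratic_space affine list \<Rightarrow>\<^sub>0 complex" / heis_eq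
  by (rule equivp_heis_eq)

instantiation heis :: (complex_quadratic_space) complex_vector
begin

lift_definition zero_heis :: "'a heis" is 0 .

lift_definition plus_heis :: "'a heis \<Rightarrow> 'a heis \<Rightarrow> 'a heis" is "(+)"
proof -
  fix f f' g g' :: "'a affine list \<Rightarrow>\<^sub>0 complex"
  assume "heis_eq f f'" "heis_eq g g'"
  then have "(f - f') + (g - g') \<in> cvec.span heis_relations"
    unfolding heis_eq_def by (rule cvec.span_add)
  then show "heis_eq (f + g) (f' + g')"
    by (simp add: heis_eq_def add_diff_add)
qed

lift_definition minus_heis :: "'a heis \<Rightarrow> 'a heis \<Rightarrow> 'a heis" is "(-)"
proof -
  fix f f' g g' :: "'a affine list \<Rightarrow>\<^sub>0 complex"
  assume "heis_eq f f'" "heis_eq g g'"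
  then have "(f - f') - (g - g') \<in> cvec.span heis_relations"
    unfolding heis_eq_def by (rule cvec.span_diff)
  moreover have "(f - f') - (g - g') = (f - g) - (f' - g')"
    by simp
  ultimately show "heis_eq (f - g) (f' - g')"
    by (simp only: heis_eq_def)
qed

lift_definition uminus_heis :: "'a heis \<Rightarrow> 'a heis" is uminus
proof -
  fix f f' :: "'a affine list \<Rightarrow>\<^sub>0 complex"
  assume "heis_eq f f'"
  then have "- (f - f') \<in> cvec.span heis_relations"
    unfolding heis_eq_def by (rule cvec.span_neg)
  then show "heis_eq (- f) (- f')"
    by (simp add: heis_eq_def)
qed

lift_definition scaleC_heis :: "complex \<Rightarrow> 'a heis \<Rightarrow> 'a heis" is scaleC
proof -
  fix c and f f' :: "'a affine list \<Rightarrow>\<^sub>0 complex"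
  assume "heis_eq f f'"
  then have "c *C (f - f') \<in> cvec.span heis_relations"
    unfolding heis_eq_def by (rule cvec.span_scale)
  then show "heis_eq (c *C f) (c *C f')"
    by (simp add: heis_eq_def cvec.scale_right_diff_distrib)
qed

instance
  by standard
    (transfer; simp add: heis_eq_def cvec.span_zero cvec.scale_right_distrib
      cvec.scale_left_distrib)+

end

definition prepend ::
    "'a affine \<Rightarrow> ('a affine list \<Rightarrow>\<^sub>0 complex) \<Rightarrow> ('a affine list \<Rightarrow>\<^sub>0 complex)" where
  "prepend x f = (\<Sum>w\<in>Poly_Mapping.keys f.
     Poly_Mapping.single (x # w) (Poly_Mapping.lookup f w))"

lemma lookup_prepend:
  "Poly_Mapping.lookup (prepend x f) v =
     (case v of [] \<Rightarrow> 0 | y # w \<Rightarrow> if y = x then Poly_Mapping.lookup f w else 0)"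
proof (cases v)
  case Nil
  then show ?thesis
    by (simp add: prepend_def lookup_sum lookup_single)
next
  case (Cons y w)
  have "Poly_Mapping.lookup (prepend x f) v =
      (\<Sum>u\<in>Poly_Mapping.keys f. if u = w then (if y = x then Poly_Mapping.lookup f w else 0) else 0)"
    unfolding prepend_def lookup_sum lookup_single Cons
    by (rule sum.cong) (auto simp: when_def)
  then show ?thesis
    by (simp add: Cons in_keys_iff)
qed

lemma prepend_add: "prepend x (f + g) = prepend x f + prepend x g"
  by (rule poly_mapping_eqI) (simp add: lookup_prepend lookup_add split: list.split)

lemma prepend_diff: "prepend x (f - g) = prepend x f - prepend x g"
  by (rule poly_mapping_eqI) (simp add: lookup_prepend lookup_minus split: list.split)

lemma prepend_scaleC: "prepend x (c *C f) = c *C prepend x f"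
  by (rule poly_mapping_eqI)
    (simp add: lookup_prepend lookup_scaleC scaleC_complex_def split: list.split)

lemma prepend_word: "prepend x (word w) = word (x # w)"
  by (simp add: prepend_def word_def)

lemma prepend_relations:
  assumes "r \<in> heis_relations"
  shows "prepend x r \<in> heis_relations"
proof -
  consider
    (add) p y z q where "r = word (p @ [y + z] @ q) - word (p @ [y] @ q) - word (p @ [z] @ q)"
  | (scale) p c y q where "r = word (p @ [c *C y] @ q) - c *C word (p @ [y] @ q)"
  | (bracket) p y z q where
      "r = word (p @ [y, z] @ q) - word (p @ [z, y] @ q) - word (p @ [bracket y z] @ q)"
  | (nonneg) p y where "r = word (p @ [y]) - snd y *C word p" "y \<in> affine_nonneg"
    using assms unfolding heis_relations_def by blast
  then show ?thesis
  proof cases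
    case add
    then have "prepend x r =
        word ((x # p) @ [y + z] @ q) - word ((x # p) @ [y] @ q) - word ((x # p) @ [z] @ q)"
      by (simp add: prepend_diff prepend_word)
    then show ?thesis
      unfolding heis_relations_def by blast
  next
    case scale
    then have "prepend x r = word ((x # p) @ [c *C y] @ q) - c *C word ((x # p) @ [y] @ q)"
      by (simp add: prepend_diff prepend_word prepend_scaleC)
    then show ?thesis
      unfolding heis_relations_def by blast
  next
    case bracket
    then have "prepend x r = word ((x # p) @ [y, z] @ q) - word ((x # p) @ [z, y] @ q)
        - word ((x # p) @ [bracket y z] @ q)"
      by (simp add: prepend_diff prepend_word)
    then show ?thesis
      unfolding heis_relations_def by blast
  next
    case nonneg
    then have "prepend x r = word ((x # p) @ [y]) - snd y *C word (x # p)"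
      by (simp add: prepend_diff prepend_word prepend_scaleC)
    with nonneg show ?thesis
      unfolding heis_relations_def by blast
  qed
qed

lemma prepend_span:
  assumes "r \<in> cvec.span heis_relations"
  shows "prepend x r \<in> cvec.span heis_relations"
  using assms
proof (induction rule: cvec.span_induct_alt)
  case base
  show ?case by (simp add: prepend_def cvec.span_zero)
next
  case (step c r s)
  then show ?case
    by (simp add: prepend_add prepend_scaleC prepend_relations cvec.span_add cvec.span_scale
        cvec.span_base)
qed

lift_definition affine_act ::
    "'a::complex_quadratic_space affine \<Rightarrow> 'a heis \<Rightarrow> 'a heis" is prepend
  unfolding heis_eq_def by (simp flip: prepend_diff add: prepend_span)

lift_definition vacuum :: "'a::complex_quadratic_space heis" is "word []" .

text \<open>\<open>mode u n\<close> is the operator \<open>u(n)\<close>.\<close>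

definition mode :: "'a::complex_quadratic_space \<Rightarrow> int \<Rightarrow> 'a heis \<Rightarrow> 'a heis" where
  "mode u n = affine_act (Poly_Mapping.single n u, 0)"

definition emb :: "'a::complex_quadratic_space \<Rightarrow> 'a heis" where
  "emb u = mode u (-1) vacuum"

definition conformal_vector ::
    "'a::complex_quadratic_space set \<Rightarrow> 'a \<Rightarrow> 'a heis" where
  "conformal_vector B h =
     (1 / 2) *C (\<Sum>b\<in>B. mode b (-1) (mode b (-1) vacuum)) + mode h (-2) vacuum"

text \<open>
  The vertex algebra structure on the induced module is determined by the fields of its
  generators.
\<close>

definition heisenberg_vertex_algebra ::
    "('a::complex_quadratic_space heis \<Rightarrow> int \<Rightarrow> 'a heis \<Rightarrow> 'a heis) \<Rightarrow> bool" where
  "heisenberg_vertex_algebra Y \<longleftrightarrow>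
     vertex_algebra Y vacuum \<and> (\<forall>u n v. Y (emb u) n v = mode u n v)"

text \<open>
  The actions of automorphisms of the induced module on the underlying quadratic space,
  identified with the weight-one subspace via \<open>emb\<close>, and on pairs in \<open>Reg\<close>.
\<close>

definition act_h ::
    "('a::complex_quadratic_space heis \<Rightarrow> 'a heis) \<Rightarrow> 'a \<Rightarrow> 'a" where
  "act_h \<sigma> u = inv emb (\<sigma> (emb u))"

definition act_Reg ::
    "('a::complex_quadratic_space heis \<Rightarrow> 'a heis) \<Rightarrow> 'a set \<times> 'a \<Rightarrow> 'a set \<times> 'a" where
  "act_Reg \<sigma> = (\<lambda>(S, a). (act_h \<sigma> ` S, act_h \<sigma> a))"

end

theory Submission
  imports Defs "HOL-Library.Multiset"
begin

text \<open>
  Every vector of weight two is a quadratic vector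
  \<open>quad A a = 1/2 \<Sum> (A b)(-1) b(-1) \<one> + a(-2) \<one>\<close>, the sum running over an
  orthonormal basis, for a self-adjoint operator \<open>A\<close> on the quadratic space and an element
  \<open>a\<close>. The conformal vector is \<open>quad id h\<close>. The commutator of a mode of \<open>quad A a\<close>
  with \<open>u(m)\<close> is again a mode of the quadratic space, plus a scalar
  (\<open>quad_mode_commutator\<close>), and the products of quadratic vectors of nonnegative index follow
  from this.

  Let \<open>w\<close> be semi-conformal. The Virasoro relations applied to the vacuum give
  \<open>w\<^sub>1 w = 2w\<close> and \<open>w\<^sub>2 w = 0\<close>, and since \<open>\<omega>\<close> agrees with \<open>w\<close> on the subalgebra, also
  \<open>\<omega>\<^sub>1 w = 2w\<close> and \<open>\<omega>\<^sub>2 w = 0\<close>. So \<open>w\<close> has weight two. For \<open>w = quad A a\<close>, the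
  equation \<open>w\<^sub>1 w = 2w\<close> gives \<open>A\<^sup>2 = A\<close>, and \<open>\<omega>\<^sub>2 w = 0\<close> gives \<open>a = A h\<close>. Hence
  \<open>A\<close> is the orthogonal projection onto a regular subspace \<open>S\<close>, and \<open>w\<close> is determined by
  \<open>S\<close>.

  Conversely, for such a \<open>w\<close> put \<open>t = \<omega> - w\<close>. The vectors killed by all \<open>t\<^sub>n\<close> with
  \<open>n \<ge> 0\<close> form a vertex subalgebra, it contains \<open>w\<close>, and on it \<open>w\<^sub>n = \<omega>\<^sub>n\<close> for
  \<open>n \<ge> 0\<close>; so it inherits the derivative property and the grading from \<open>\<omega>\<close>
  (\<open>projection_semiconformal\<close>). The equations \<open>\<omega>\<^sub>1 w = 2w\<close>, \<open>\<omega>\<^sub>2 w = 0\<close>,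
  \<open>w\<^sub>1 w = 2w\<close> therefore characterize the semi-conformal vectors
  (\<open>semiconformal_iff_equations\<close>), and they are visibly stable under automorphisms.

  In terms of the projections \<open>P\<close>, \<open>Q\<close> onto \<open>S\<close>, \<open>T\<close>, the first condition of the order says
  \<open>PQ + QP = 2P\<close>, which forces \<open>S \<subseteq> T\<close>, and \<open>S \<subseteq> T\<close> implies all of them
  (\<open>Sc_le_iff_subset\<close>). The order on regular pairs also amounts to inclusion, so chains are
  chains of regular subspaces: their length is bounded by the dimension, and the spans of initial
  segments of an orthonormal basis attain the bound.

  Uniqueness of \<open>A\<close> and \<open>a\<close> rests on the vacuum being nonzero in the induced module. This is
  proved by constructing vacuum expectation values of words (\<open>vev_relations\<close>).
\<close>

section \<open>The induced module\<close>

lemma heis_eq_0: "abs_heis f = 0 \<longleftrightarrow> f \<in> cvec.span heis_relations"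
  by (simp add: zero_heis.abs_eq heis.abs_eq_iff heis_eq_def)

lemma heis_word_induct [case_names word add scale]:
  assumes "\<And>w. P (abs_heis (word w))"
    and "\<And>u v. P u \<Longrightarrow> P v \<Longrightarrow> P (u + v)"
    and "\<And>c v. P v \<Longrightarrow> P (c *C v)"
  shows "P v"
proof (induction v rule: heis.abs_induct)
  case (1 f)
  have P0: "P 0"
    using assms(3)[OF assms(1)[of "[]"], of 0] by simp
  have "f = (\<Sum>w\<in>Poly_Mapping.keys f. Poly_Mapping.lookup f w *C word w)"
    by (rule poly_mapping_eqI)
      (auto simp: lookup_sum lookup_scaleC word_def lookup_single scaleC_complex_def when_def
        in_keys_iff if_distrib cong: if_cong)
  moreover have "P (abs_heis (\<Sum>w\<in>W. Poly_Mapping.lookup f w *C word w))" for W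
  proof (induction W rule: infinite_finite_induct)
    case (insert w W)
    then show ?case
      using assms by (simp flip: plus_heis.abs_eq scaleC_heis.abs_eq)
  qed (use P0 in \<open>simp_all add: zero_heis.abs_eq\<close>)
  ultimately show ?case by metis
qed

lemma affine_act_add_right: "affine_act x (u + v) = affine_act x u + affine_act x v"
  by transfer (simp add: prepend_add heis_eq_def cvec.span_zero)

lemma affine_act_scale_right: "affine_act x (c *C v) = c *C affine_act x v"
  by transfer (simp add: prepend_scaleC heis_eq_def cvec.span_zero)

lemma affine_act_word: "affine_act x (abs_heis (word w)) = abs_heis (word (x # w))"
  by (simp add: affine_act.abs_eq prepend_word)

lemma abs_heis_eqI: "f - g \<in> heis_relations \<Longrightarrow> abs_heis f = abs_heis g"
  by (simp add: heis.abs_eq_iff heis_eq_def cvec.span_base)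

lemma affine_act_add_left: "affine_act (x + y) v = affine_act x v + affine_act y v"
proof (induction v rule: heis_word_induct)
  case (word w)
  have "word ([] @ [x + y] @ w) - word ([] @ [x] @ w) - word ([] @ [y] @ w) \<in> heis_relations"
    unfolding heis_relations_def by blast
  then have "abs_heis (word ((x + y) # w)) = abs_heis (word (x # w) + word (y # w))"
    by (intro abs_heis_eqI) (simp add: diff_diff_eq)
  then show ?case by (simp add: affine_act_word plus_heis.abs_eq)
qed (simp_all add: affine_act_add_right affine_act_scale_right scaleC_add_right)

lemma affine_act_scale_left: "affine_act (c *C x) v = c *C affine_act x v"
proof (induction v rule: heis_word_induct)
  case (word w)
  have "word ([] @ [c *C x] @ w) - c *C word ([] @ [x] @ w) \<in> heis_relations"
    unfolding heis_relations_def by blast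
  then have "abs_heis (word ((c *C x) # w)) = abs_heis (c *C word (x # w))"
    by (intro abs_heis_eqI) simp
  then show ?case by (simp add: affine_act_word scaleC_heis.abs_eq)
qed (simp_all add: affine_act_add_right affine_act_scale_right scaleC_add_right scaleC_scaleC mult.commute)

lemma affine_act_zero_left: "affine_act 0 v = 0"
  using affine_act_scale_left[of 0 0 v] by simp

lemma affine_act_commutator:
  "affine_act x (affine_act y v) = affine_act y (affine_act x v) + affine_act (bracket x y) v"
proof (induction v rule: heis_word_induct)
  case (word w)
  have "word ([] @ [x, y] @ w) - word ([] @ [y, x] @ w) - word ([] @ [bracket x y] @ w) \<in> heis_relations"
    unfolding heis_relations_def by blast
  then have "abs_heis (word (x # y # w)) = abs_heis (word (y # x # w) + word (bracket x y # w))"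
    by (intro abs_heis_eqI) (simp add: diff_diff_eq)
  then show ?case by (simp add: affine_act_word plus_heis.abs_eq)
next
  case (add u v)
  then show ?case by (simp add: affine_act_add_right algebra_simps)
qed (simp_all add: affine_act_add_right affine_act_scale_right scaleC_add_right)

lemma affine_act_vacuum:
  assumes "x \<in> affine_nonneg"
  shows "affine_act x vacuum = snd x *C vacuum"
proof -
  have "word ([] @ [x]) - snd x *C word [] \<in> heis_relations"
    unfolding heis_relations_def using assms by blast
  then show ?thesis
    by (auto intro!: abs_heis_eqI simp: vacuum.abs_eq affine_act_word scaleC_heis.abs_eq)
qed

lemma heis_induct [case_names vacuum act add scale]:
  assumes "P vacuum"
    and "\<And>x v. P v \<Longrightarrow> P (affine_act x v)"
    and "\<And>u v. P u \<Longrightarrow> P v \<Longrightarrow> P (u + v)"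
    and "\<And>c v. P v \<Longrightarrow> P (c *C v)"
  shows "P v"
proof (induction v rule: heis_word_induct)
  case (word w)
  then show ?case
    by (induction w) (use assms in \<open>auto simp: vacuum.abs_eq simp flip: affine_act_word\<close>)
qed (use assms in auto)

text \<open>Central elements commute with everything, so the scalar is read off at the vacuum.\<close>
lemma affine_act_central: "affine_act (0, c) v = c *C v"
proof (induction v rule: heis_induct)
  case vacuum
  show ?case by (subst affine_act_vacuum) (auto simp: affine_nonneg_def)
next
  case (act x v)
  have "bracket (0, c) x = 0" by (simp add: bracket_def zero_prod_def)
  then show ?case using act affine_act_commutator[of "(0, c)" x v]
    by (simp add: affine_act_zero_left affine_act_scale_right)
qed (simp_all add: affine_act_add_right affine_act_scale_right scaleC_add_right scaleC_scaleC mult.commute)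

section \<open>Bilinearity of the form\<close>

lemma form_zero_left [simp]: "form 0 y = 0" for y :: "'a::complex_quadratic_space"
  using form_scaleC_left[of 0 0 y] by simp

lemma form_add_right: "form x (y + z) = form x y + form x z" for x :: "'a::complex_quadratic_space"
  by (metis form_add_left form_sym)

lemma form_scaleC_right: "form x (c *C y) = c * form x y" for x :: "'a::complex_quadratic_space"
  by (metis form_scaleC_left form_sym)

lemma form_zero_right [simp]: "form x 0 = 0" for x :: "'a::complex_quadratic_space"
  by (metis form_zero_left form_sym)

lemma form_minus_left [simp]: "form (- x) y = - form x y" for x :: "'a::complex_quadratic_space"
  using form_add_left[of x "- x" y] by (simp add: eq_neg_iff_add_eq_0 add.commute)

lemma form_diff_left: "form (x - y) z = form x z - form y z" for x :: "'a::complex_quadratic_space"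
  using form_add_left[of x "- y" z] by simp

lemma form_diff_right: "form z (x - y) = form z x - form z y" for x :: "'a::complex_quadratic_space"
  by (metis form_diff_left form_sym)

lemma form_sum_left: "form (\<Sum>i\<in>I. f i) y = (\<Sum>i\<in>I. form (f i) y)"
  for y :: "'a::complex_quadratic_space"
  by (induction I rule: infinite_finite_induct) (simp_all add: form_add_left)

section \<open>Modes on the induced module\<close>

lemma mode_add_right: "mode a n (u + v) = mode a n u + mode a n v"
  by (simp add: mode_def affine_act_add_right)

lemma mode_scale_right: "mode a n (c *C v) = c *C mode a n v"
  by (simp add: mode_def affine_act_scale_right)

lemma mode_add_left: "mode (a + b) n v = mode a n v + mode b n v"
  using affine_act_add_left[of "(Poly_Mapping.single n a, 0)" "(Poly_Mapping.single n b, 0)" v]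
  by (simp add: mode_def single_add)

lemma single_scaleC: "c *C Poly_Mapping.single n a = Poly_Mapping.single n (c *C a)"
  by (rule poly_mapping_eqI) (simp add: lookup_scaleC lookup_single when_def)

lemma mode_scale_left: "mode (c *C a) n v = c *C mode a n v"
  using affine_act_scale_left[of c "(Poly_Mapping.single n a, 0)" v]
  by (simp add: mode_def scaleC_prod_def single_scaleC scaleC_complex_def)

lemma mode_commutator:
  "mode a m (mode b n v) =
   mode b n (mode a m v) + (if m + n = 0 then of_int m * form a b else 0) *C v"
proof -
  have "bracket (Poly_Mapping.single m a, 0) (Poly_Mapping.single n b, 0) =
      (0, if m + n = 0 then of_int m * form a b else 0)"
    by (auto simp: bracket_def lookup_single when_def)
  then show ?thesis
    unfolding mode_def using affine_act_commutator[of "(Poly_Mapping.single m a, 0)" "(Poly_Mapping.single n b, 0)" v]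
    by (simp add: affine_act_central)
qed

lemma mode_vacuum: "n \<ge> 0 \<Longrightarrow> mode a n vacuum = 0"
  by (simp add: mode_def affine_act_vacuum affine_nonneg_def lookup_single when_def)

lemma affine_act_modes:
  "affine_act (f, c) v = (\<Sum>n\<in>Poly_Mapping.keys f. mode (Poly_Mapping.lookup f n) n v) + c *C v"
proof -
  have eq: "(f, c) = (\<Sum>n\<in>Poly_Mapping.keys f. (Poly_Mapping.single n (Poly_Mapping.lookup f n), 0)) + (0, c)"
  proof -
    have "(\<Sum>n\<in>Poly_Mapping.keys f. Poly_Mapping.single n (Poly_Mapping.lookup f n)) = f"
      by (rule poly_mapping_eqI) (auto simp: lookup_sum lookup_single when_def in_keys_iff)
    then show ?thesis by (simp add: prod_eq_iff fst_sum snd_sum)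
  qed
  have "affine_act (\<Sum>n\<in>I. (Poly_Mapping.single n (Poly_Mapping.lookup f n), 0)) v =
     (\<Sum>n\<in>I. mode (Poly_Mapping.lookup f n) n v)" for I
    by (induction I rule: infinite_finite_induct)
       (simp_all add: affine_act_zero_left affine_act_add_left mode_def)
  then show ?thesis
    by (subst eq) (simp only: affine_act_add_left affine_act_central)
qed

lemma heis_mode_induct [case_names vacuum mode add scale]:
  assumes "P vacuum"
    and "\<And>a n v. P v \<Longrightarrow> P (mode a n v)"
    and "\<And>u v. P u \<Longrightarrow> P v \<Longrightarrow> P (u + v)"
    and "\<And>c v. P v \<Longrightarrow> P (c *C v)"
  shows "P v"
proof (induction v rule: heis_induct)
  case (act x v)
  have P0: "P 0" using assms(4)[OF assms(1), of 0] by simp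
  have "P (\<Sum>n\<in>I. mode (Poly_Mapping.lookup (fst x) n) n v)" for I
    by (induction I rule: infinite_finite_induct) (use P0 act assms in auto)
  then show ?case using affine_act_modes[of "fst x" "snd x" v] act assms by simp
qed (use assms in auto)

section \<open>Vacuum expectation values\<close>

text \<open>
  The scalar that arises when the annihilating part of \<open>x\<close> is moved to the right past \<open>y\<close>.
  The bracket is its antisymmetrization.
\<close>
definition pairing :: "'a::complex_quadratic_space affine \<Rightarrow> 'a affine \<Rightarrow> complex" where
  "pairing x y = (\<Sum>m\<in>{m\<in>Poly_Mapping.keys (fst x). m > 0}.
      of_int m * form (Poly_Mapping.lookup (fst x) m) (Poly_Mapping.lookup (fst y) (- m)))"

lemma pairing_superset:
  assumes "finite M" "Poly_Mapping.keys (fst x) \<subseteq> M"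
  shows "pairing x y = (\<Sum>m\<in>{m\<in>M. m > 0}.
      of_int m * form (Poly_Mapping.lookup (fst x) m) (Poly_Mapping.lookup (fst y) (- m)))"
  unfolding pairing_def
  by (rule sum.mono_neutral_left) (use assms in \<open>auto simp: in_keys_iff\<close>)

lemma pairing_add_right: "pairing x (y + z) = pairing x y + pairing x z"
  by (simp add: pairing_def lookup_add form_add_right algebra_simps sum.distrib)

lemma pairing_scale_right: "pairing x (c *C y) = c * pairing x y"
  by (simp add: pairing_def scaleC_prod_def lookup_scaleC form_scaleC_right sum_distrib_left algebra_simps)

lemma pairing_add_left: "pairing (x + y) z = pairing x z + pairing y z"
proof -
  let ?M = "Poly_Mapping.keys (fst x) \<union> Poly_Mapping.keys (fst y)"
  have "Poly_Mapping.keys (fst (x + y)) \<subseteq> ?M"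
    using Poly_Mapping.keys_add[of "fst x" "fst y"] by simp
  then show ?thesis
    by (simp add: pairing_superset[of ?M] lookup_add form_add_left algebra_simps sum.distrib)
qed

lemma pairing_scale_left: "pairing (c *C x) y = c * pairing x y"
proof -
  have "Poly_Mapping.keys (fst (c *C x)) \<subseteq> Poly_Mapping.keys (fst x)"
    by (auto simp: in_keys_iff scaleC_prod_def lookup_scaleC)
  then show ?thesis
    by (simp add: pairing_superset[of "Poly_Mapping.keys (fst x)"] scaleC_prod_def
        lookup_scaleC form_scaleC_left sum_distrib_left algebra_simps)
qed

lemma bracket_pairing: "bracket x y = (0, pairing x y - pairing y x)"
proof -
  let ?K = "Poly_Mapping.keys (fst x) \<union> uminus ` Poly_Mapping.keys (fst y)"
  let ?t = "\<lambda>m. of_int m * form (Poly_Mapping.lookup (fst x) m) (Poly_Mapping.lookup (fst y) (- m))"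
  have "snd (bracket x y) = (\<Sum>m\<in>?K. ?t m)"
    unfolding bracket_def snd_conv by (rule sum.mono_neutral_left) (auto simp: in_keys_iff)
  also have "\<dots> = (\<Sum>m\<in>{m\<in>?K. m > 0}. ?t m) + (\<Sum>m\<in>{m\<in>?K. m < 0}. ?t m)"
  proof -
    have "(\<Sum>m\<in>?K. ?t m) = (\<Sum>m\<in>{m\<in>?K. m > 0} \<union> {m\<in>?K. m < 0}. ?t m)"
    proof (rule sum.mono_neutral_right)
      show "\<forall>m\<in>?K - ({m\<in>?K. m > 0} \<union> {m\<in>?K. m < 0}). ?t m = 0"
      proof
        fix m assume "m \<in> ?K - ({m\<in>?K. m > 0} \<union> {m\<in>?K. m < 0})"
        then have "m = 0" by (metis (mono_tags, lifting) DiffE UnCI linorder_cases mem_Collect_eq)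
        then show "?t m = 0" by simp
      qed
    qed auto
    also have "\<dots> = (\<Sum>m\<in>{m\<in>?K. m > 0}. ?t m) + (\<Sum>m\<in>{m\<in>?K. m < 0}. ?t m)"
      by (rule sum.union_disjoint) auto
    finally show ?thesis .
  qed
  also have "(\<Sum>m\<in>{m\<in>?K. m > 0}. ?t m) = pairing x y"
    by (subst pairing_superset[of ?K]) auto
  also have "(\<Sum>m\<in>{m\<in>?K. m < 0}. ?t m) = - pairing y x"
  proof -
    have im: "m \<in> uminus ` A \<longleftrightarrow> - m \<in> A" for m :: int and A
      by force
    have "pairing y x = (\<Sum>m\<in>{m\<in>uminus ` ?K. m > 0}.
      of_int m * form (Poly_Mapping.lookup (fst y) m) (Poly_Mapping.lookup (fst x) (- m)))"
      by (subst pairing_superset[of "uminus ` ?K"]) (auto simp: image_Un image_image)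
    also have "\<dots> = (\<Sum>m\<in>{m\<in>?K. m < 0}. - ?t m)"
      by (rule sum.reindex_bij_witness[of _ uminus uminus]) (auto simp: form_sym im)
    finally show ?thesis by (simp add: sum_negf)
  qed
  finally show ?thesis by (simp add: bracket_def)
qed

lemma pairing_nonneg: "y \<in> affine_nonneg \<Longrightarrow> pairing x y = 0"
  by (auto simp: pairing_def affine_nonneg_def intro!: sum.neutral)

text \<open>
  A vector \<open>v\<close> of the Fock space is recorded by the function sending a multiset of operators
  to the vacuum expectation value of the product of their annihilating parts applied to \<open>v\<close>;
  annihilating parts commute, so multisets suffice. On such functions, \<open>x\<close> acts by its
  central scalar, by joining the multiset, and by contractions with its members.
\<close>
type_synonym 'a correlator = "'a affine multiset \<Rightarrow> complex"

definition contract :: "'a::complex_quadratic_space affine \<Rightarrow> 'a correlator \<Rightarrow> 'a correlator" where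
  "contract y \<psi> M = (\<Sum>z\<in>#M. pairing z y * \<psi> (M - {#z#}))"

lemma contract_empty [simp]: "contract y \<psi> {#} = 0"
  by (simp add: contract_def)

text \<open>This recursion makes commutation relations provable by induction on the multiset.\<close>
lemma contract_add_mset:
  "contract y \<psi> (add_mset z M) = pairing z y * \<psi> M + contract y (\<lambda>N. \<psi> (add_mset z N)) M"
proof -
  have "image_mset (\<lambda>u. pairing u y * \<psi> (add_mset z M - {#u#})) M =
      image_mset (\<lambda>u. pairing u y * \<psi> (add_mset z (M - {#u#}))) M"
    by (rule image_mset_cong) (simp add: diff_union_swap2)
  then show ?thesis by (simp add: contract_def)
qed

lemma contract_add: "contract y (\<lambda>N. \<phi> N + \<psi> N) M = contract y \<phi> M + contract y \<psi> M"
  by (simp add: contract_def algebra_simps sum_mset.distrib)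

lemma contract_scale: "contract y (\<lambda>N. c * \<psi> N) M = c * contract y \<psi> M"
  by (simp add: contract_def sum_mset_distrib_left algebra_simps)

lemma contract_commute: "contract x (contract y \<psi>) M = contract y (contract x \<psi>) M"
proof (induction M arbitrary: \<psi>)
  case (add z M)
  then show ?case by (simp add: contract_add_mset contract_add contract_scale)
qed simp

lemma contract_add_left: "contract (x + y) \<psi> M = contract x \<psi> M + contract y \<psi> M"
  by (simp add: contract_def pairing_add_right algebra_simps sum_mset.distrib)

lemma contract_scale_left: "contract (c *C x) \<psi> M = c * contract x \<psi> M"
  by (simp add: contract_def pairing_scale_right sum_mset_distrib_left algebra_simps)

lemma contract_nonneg: "x \<in> affine_nonneg \<Longrightarrow> contract x \<psi> M = 0"
  by (simp add: contract_def pairing_nonneg)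

text \<open>
  Joining a multiset respects the relations only on functions of this kind: linear in each
  operator, and zero when one of them is central, as its annihilating part is zero.
\<close>
definition multilinear :: "'a::complex_quadratic_space correlator \<Rightarrow> bool" where
  "multilinear \<psi> \<longleftrightarrow>
     (\<forall>x y M. \<psi> (add_mset (x + y) M) = \<psi> (add_mset x M) + \<psi> (add_mset y M)) \<and>
     (\<forall>c x M. \<psi> (add_mset (c *C x) M) = c * \<psi> (add_mset x M)) \<and>
     (\<forall>c M. \<psi> (add_mset (0, c) M) = 0)"

lemma multilinearD:
  assumes "multilinear \<psi>"
  shows "\<psi> (add_mset (x + y) M) = \<psi> (add_mset x M) + \<psi> (add_mset y M)"
    and "\<psi> (add_mset (c *C x) M) = c * \<psi> (add_mset x M)"
    and "\<psi> (add_mset (0, c) M) = 0"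
  using assms unfolding multilinear_def by blast+

definition insertion :: "'a::complex_quadratic_space affine \<Rightarrow> 'a correlator \<Rightarrow> 'a correlator" where
  "insertion x \<psi> M = snd x * \<psi> M + \<psi> (add_mset x M) + contract x \<psi> M"

primrec correlation :: "'a::complex_quadratic_space affine list \<Rightarrow> 'a correlator" where
  "correlation [] = (\<lambda>M. if M = {#} then 1 else 0)"
| "correlation (x # w) = insertion x (correlation w)"

lemma pairing_central: "pairing (0, c) y = 0"
  by (simp add: pairing_def)

lemma multilinear_insertion:
  assumes "multilinear \<psi>" shows "multilinear (insertion x \<psi>)"
proof -
  note lin = multilinearD[OF assms]
  have "insertion x \<psi> (add_mset (y + z) M) = insertion x \<psi> (add_mset y M) + insertion x \<psi> (add_mset z M)" for y z M
    by (simp add: insertion_def contract_add_mset add_mset_commute[of x] lin contract_add pairing_add_left algebra_simps)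
  moreover have "insertion x \<psi> (add_mset (c *C y) M) = c * insertion x \<psi> (add_mset y M)" for c y M
    by (simp add: insertion_def contract_add_mset add_mset_commute[of x] lin contract_scale pairing_scale_left algebra_simps)
  moreover have "insertion x \<psi> (add_mset (0, c) M) = 0" for c M
    using contract_scale[of x 0 \<psi> M]
    by (simp add: insertion_def contract_add_mset add_mset_commute[of x] lin pairing_central)
  ultimately show ?thesis by (auto simp: multilinear_def)
qed

lemma multilinear_correlation: "multilinear (correlation w)"
  by (induction w) (auto simp: multilinear_insertion, simp add: multilinear_def)

lemma insertion_add: "insertion x (\<lambda>N. \<phi> N + \<psi> N) M = insertion x \<phi> M + insertion x \<psi> M"
  by (simp add: insertion_def contract_add algebra_simps)

lemma insertion_scale: "insertion x (\<lambda>N. c * \<psi> N) M = c * insertion x \<psi> M"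
  by (simp add: insertion_def contract_scale algebra_simps)

text \<open>
  Joining operations commute, and so do contractions; the scalar comes from contracting one
  operator with the other one, which has just joined.
\<close>
lemma insertion_commutator:
  "insertion x (insertion y \<psi>) M =
     insertion y (insertion x \<psi>) M + (pairing x y - pairing y x) * \<psi> M"
proof -
  have *: "contract x (insertion y \<psi>) M = snd y * contract x \<psi> M
      + contract x (\<lambda>N. \<psi> (add_mset y N)) M + contract x (contract y \<psi>) M" for x y
    unfolding insertion_def [abs_def] by (simp add: contract_add contract_scale)
  show ?thesis
    by (simp add: insertion_def[of x "insertion y \<psi>"] insertion_def[of y "insertion x \<psi>"] *)
       (simp add: insertion_def contract_add_mset contract_commute[of y x] add_mset_commute[of y x] algebra_simps)
qed

lemma correlation_append:
  "correlation (p @ w) = foldr insertion p (correlation w)"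
  by (induction p) auto

lemma foldr_insertion_add:
  "foldr insertion p (\<lambda>N. \<phi> N + \<psi> N) = (\<lambda>M. foldr insertion p \<phi> M + foldr insertion p \<psi> M)"
  by (induction p) (auto simp: insertion_add)

lemma foldr_insertion_scale:
  "foldr insertion p (\<lambda>N. c * \<psi> N) = (\<lambda>M. c * foldr insertion p \<psi> M)"
  by (induction p) (auto simp: insertion_scale)

definition vev :: "('a::complex_quadratic_space affine list \<Rightarrow>\<^sub>0 complex) \<Rightarrow> complex" where
  "vev f = (\<Sum>w\<in>Poly_Mapping.keys f. Poly_Mapping.lookup f w * correlation w {#})"

lemma vev_superset:
  "finite W \<Longrightarrow> Poly_Mapping.keys f \<subseteq> W \<Longrightarrow>
    vev f = (\<Sum>w\<in>W. Poly_Mapping.lookup f w * correlation w {#})"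
  unfolding vev_def by (rule sum.mono_neutral_left) (auto simp: in_keys_iff)

lemma vev_add: "vev (f + g) = vev f + vev g"
proof -
  let ?W = "Poly_Mapping.keys f \<union> Poly_Mapping.keys g"
  show ?thesis
    using Poly_Mapping.keys_add[of f g]
    by (simp add: vev_superset[of ?W] lookup_add algebra_simps sum.distrib)
qed

lemma vev_scale: "vev (c *C f) = c * vev f"
proof -
  have "Poly_Mapping.keys (c *C f) \<subseteq> Poly_Mapping.keys f"
    by (auto simp: in_keys_iff lookup_scaleC scaleC_complex_def)
  then show ?thesis
    by (simp add: vev_superset[of "Poly_Mapping.keys f"] lookup_scaleC scaleC_complex_def sum_distrib_left algebra_simps)
qed

lemma vev_diff: "vev (f - g) = vev f - vev g"
  using vev_add[of "f - g" g] by simp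

lemma vev_word: "vev (word w) = correlation w {#}"
  by (simp add: vev_def word_def)

text \<open>
  A prefix acts by a linear operator, so the relations need only be checked after removing it. For
  the last family, an operator of the nonnegative part has zero contraction with every operator to
  its left, and the function of the vacuum vanishes on nonempty multisets.
\<close>
lemma vev_relations:
  fixes r :: "'a::complex_quadratic_space affine list \<Rightarrow>\<^sub>0 complex"
  assumes "r \<in> heis_relations" shows "vev r = 0"
proof -
  consider
    (add) p y z q where "r = word (p @ [y + z] @ q) - word (p @ [y] @ q) - word (p @ [z] @ q)"
  | (scale) p c y q where "r = word (p @ [c *C y] @ q) - c *C word (p @ [y] @ q)"
  | (bracket) p y z q where
      "r = word (p @ [y, z] @ q) - word (p @ [z, y] @ q) - word (p @ [bracket y z] @ q)"
  | (nonneg) p y where "r = word (p @ [y]) - snd y *C word p" "y \<in> affine_nonneg"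
    using assms unfolding heis_relations_def by blast
  then show ?thesis
  proof cases
    case (add p y z q)
    have "insertion (y + z) (correlation q) = (\<lambda>M. insertion y (correlation q) M + insertion z (correlation q) M)"
      by (simp add: fun_eq_iff insertion_def contract_add_left multilinearD[OF multilinear_correlation] algebra_simps)
    then show ?thesis
      by (simp add: add vev_diff vev_word correlation_append foldr_insertion_add)
  next
    case (scale p c y q)
    have "insertion (c *C y) (correlation q) = (\<lambda>M. c * insertion y (correlation q) M)"
      by (simp add: fun_eq_iff insertion_def contract_scale_left multilinearD[OF multilinear_correlation] algebra_simps)
        (simp add: scaleC_prod_def scaleC_complex_def)
    then show ?thesis
      by (simp add: scale vev_diff vev_scale vev_word correlation_append foldr_insertion_scale)
  next
    case (bracket p y z q)
    have "contract (0, c) \<psi> M = 0" for c M and \<psi> :: "'a correlator"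
      by (rule contract_nonneg) (simp add: affine_nonneg_def)
    then have "insertion (bracket y z) (correlation q) = (\<lambda>M. (pairing y z - pairing z y) * correlation q M)"
      by (simp add: fun_eq_iff insertion_def bracket_pairing multilinearD[OF multilinear_correlation])
    moreover have "insertion y (insertion z (correlation q)) =
       (\<lambda>M. insertion z (insertion y (correlation q)) M + (pairing y z - pairing z y) * correlation q M)"
      by (rule ext) (rule insertion_commutator)
    ultimately show ?thesis
      by (simp add: bracket vev_diff vev_word correlation_append foldr_insertion_add)
  next
    case (nonneg p y)
    have "insertion y (correlation []) = (\<lambda>M. snd y * correlation [] M)"
      using nonneg(2) by (auto simp: insertion_def contract_nonneg)
    then have "correlation (p @ [y]) = (\<lambda>M. snd y * correlation p M)"
      using correlation_append[of p "[]"]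
      by (simp add: correlation_append foldr_insertion_scale del: correlation.simps(1))
    then show ?thesis
      by (simp add: nonneg(1) vev_diff vev_scale vev_word)
  qed
qed

text \<open>The expectation value of the empty word is \<open>1\<close>, while it is \<open>0\<close> on the relations.\<close>
lemma vacuum_nonzero: "vacuum \<noteq> (0 :: 'a::complex_quadratic_space heis)"
proof
  assume "vacuum = (0 :: 'a heis)"
  then have "(word [] :: 'a affine list \<Rightarrow>\<^sub>0 complex) \<in> cvec.span heis_relations"
    by (simp add: vacuum.abs_eq heis_eq_0)
  then have "vev (word [] :: 'a affine list \<Rightarrow>\<^sub>0 complex) = 0"
  proof (induction rule: cvec.span_induct_alt)
    case base
    show ?case by (simp add: vev_def)
  next
    case (step c r s)
    then show ?case by (simp add: vev_add vev_scale vev_relations)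
  qed
  then show False by (simp add: vev_word)
qed

section \<open>Self-adjoint operators and orthogonal projections\<close>

lemma form_eqI: "(\<And>y. form x y = form z y) \<Longrightarrow> x = z" for x :: "'a::complex_quadratic_space"
  using form_nondegenerate[of "x - z"] by (simp add: form_diff_left)

definition selfadjoint :: "('a::complex_quadratic_space \<Rightarrow> 'a) \<Rightarrow> bool" where
  "selfadjoint A \<longleftrightarrow> (\<forall>x y. form (A x) y = form x (A y))"

lemma selfadjointD: "selfadjoint A \<Longrightarrow> form (A x) y = form x (A y)"
  by (simp add: selfadjoint_def)

text \<open>Linearity of a self-adjoint operator is automatic, as the form is nondegenerate.\<close>
lemma selfadjoint_add: "selfadjoint A \<Longrightarrow> A (x + y) = A x + A y"
  by (rule form_eqI) (simp add: selfadjointD form_add_left)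

lemma selfadjoint_scaleC: "selfadjoint A \<Longrightarrow> A (c *C x) = c *C A x"
  by (rule form_eqI) (simp add: selfadjointD form_scaleC_left)

lemma selfadjoint_id: "selfadjoint (\<lambda>x. x)"
  by (simp add: selfadjoint_def)

lemma complex_quadratic_space_finite_basis:
  obtains F :: "'a::complex_quadratic_space set"
  where "finite F" "cvec.independent F" "cvec.span F = UNIV"
proof -
  obtain E :: "'a set" where E: "finite E" "\<And>x. \<exists>c. x = (\<Sum>b\<in>E. c b *C b)"
    using finite_dimensional by auto
  have "cvec.span E = UNIV"
  proof (intro equalityI subsetI UNIV_I)
    fix x :: 'a
    obtain c where "x = (\<Sum>b\<in>E. c b *C b)" using E(2) by blast
    then show "x \<in> cvec.span E"
      by (simp add: cvec.span_sum cvec.span_scale cvec.span_base)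
  qed
  moreover obtain F where "F \<subseteq> E" "cvec.independent F" "E \<subseteq> cvec.span F"
    using cvec.maximal_independent_subset[of E] by blast
  ultimately have "cvec.span F = UNIV"
    by (metis cvec.span_mono cvec.span_span top.extremum_uniqueI)
  then show ?thesis using that \<open>F \<subseteq> E\<close> \<open>cvec.independent F\<close> E(1) finite_subset by blast
qed

lemma regular_subspace_subspace: "regular_subspace S \<Longrightarrow> cvec.subspace S"
  by (simp add: regular_subspace_def)

text \<open>
  Pairing with a basis \<open>E\<close> of \<open>S\<close> gives a linear map \<open>\<phi>\<close> from the whole space into \<open>S\<close>. Its
  kernel is the orthogonal complement of \<open>S\<close>. As \<open>S\<close> is regular, \<open>\<phi>\<close> is injective on
  \<open>S\<close>, hence maps \<open>S\<close> onto itself by dimension, and \<open>p\<close> is the preimage of \<open>\<phi> x\<close>.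
\<close>
lemma orthogonal_projection_exists:
  fixes x :: "'a::complex_quadratic_space"
  assumes "regular_subspace S"
  obtains p where "p \<in> S" "\<And>y. y \<in> S \<Longrightarrow> form (x - p) y = 0"
proof -
  obtain F :: "'a set" where F: "finite F" "cvec.independent F" "cvec.span F = UNIV"
    by (rule complex_quadratic_space_finite_basis)
  interpret fd: finite_dimensional_vector_space scaleC F
    by unfold_locales (use F in auto)
  interpret pair: finite_dimensional_vector_space_pair scaleC F scaleC F
    by unfold_locales
  have sub: "cvec.subspace S" and
    nd: "\<And>x. x \<in> S \<Longrightarrow> (\<And>y. y \<in> S \<Longrightarrow> form x y = 0) \<Longrightarrow> x = 0"
    using assms by (auto simp: regular_subspace_def)
  obtain E where E: "E \<subseteq> S" "cvec.independent E" "S \<subseteq> cvec.span E"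
    using cvec.maximal_independent_subset[of S] by blast
  have finE: "finite E" using fd.finiteI_independent[OF E(2)] .
  have span: "cvec.span E = S"
    using E sub cvec.span_minimal by blast
  define \<phi> where "\<phi> x = (\<Sum>e\<in>E. form x e *C e)" for x
  have \<phi>_lin: "Vector_Spaces.linear scaleC scaleC \<phi>"
    by unfold_locales
      (simp_all add: \<phi>_def form_add_left form_scaleC_left scaleC_add_left sum.distrib
        cvec.scale_sum_right)
  have \<phi>_in: "\<phi> x \<in> S" for x
    unfolding \<phi>_def using sub E(1) by (auto intro!: cvec.subspace_sum cvec.subspace_scale)
  have coords: "form x y = 0" if "\<phi> x = 0" "y \<in> S" for x y
  proof -
    have E0: "form x e = 0" if "e \<in> E" for e
      using E(2) finE \<open>\<phi> x = 0\<close> that unfolding \<phi>_def cvec.dependent_finite[OF finE] by blast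
    from \<open>y \<in> S\<close> have "y \<in> cvec.span E" by (simp add: span)
    then show ?thesis
      by (induction rule: cvec.span_induct_alt)
        (simp_all add: form_add_right form_scaleC_right E0)
  qed
  have "inj_on \<phi> S"
  proof (rule inj_onI)
    fix a b assume ab: "a \<in> S" "b \<in> S" "\<phi> a = \<phi> b"
    then have "\<phi> (a - b) = 0" by (simp add: \<phi>_def form_diff_left cvec.scale_left_diff_distrib sum_subtractf)
    moreover have "a - b \<in> S" using ab sub by (simp add: cvec.subspace_diff)
    ultimately show "a = b" using nd[of "a - b"] coords by auto
  qed
  then have dim: "cvec.dim (\<phi> ` S) = cvec.dim S"
    by (intro pair.dim_image_eq[OF \<phi>_lin]) (simp add: cvec.span_eq_iff[THEN iffD2, OF sub])
  have "cvec.subspace (\<phi> ` S)"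
  proof -
    interpret L: Vector_Spaces.linear scaleC scaleC \<phi> by (rule \<phi>_lin)
    show ?thesis by (rule L.subspace_image[OF sub])
  qed
  then have "\<phi> ` S = S"
    using fd.subspace_dim_equal[of "\<phi> ` S" S] sub dim \<phi>_in by auto
  then obtain p where "p \<in> S" "\<phi> p = \<phi> x" using \<phi>_in[of x] by force
  moreover have "\<phi> (x - p) = 0"
    using \<open>\<phi> p = \<phi> x\<close>
    by (simp add: \<phi>_def form_diff_left cvec.scale_left_diff_distrib sum_subtractf)
  ultimately show ?thesis using that coords by blast
qed

lemma proj_eqI:
  assumes "regular_subspace S" "p \<in> S" "\<And>y. y \<in> S \<Longrightarrow> form (x - p) y = 0"
  shows "proj S x = p"
  unfolding proj_def
proof (rule the_equality)
  show "p \<in> S \<and> (\<forall>y\<in>S. form (x - p) y = 0)" using assms by blast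
  fix q assume q: "q \<in> S \<and> (\<forall>y\<in>S. form (x - q) y = 0)"
  have "q - p \<in> S"
    using q assms by (simp add: regular_subspace_def cvec.subspace_diff)
  moreover have "form (q - p) y = 0" if "y \<in> S" for y
    using q assms(3)[OF that] that by (simp add: form_diff_left)
  ultimately have "q - p = 0"
    using assms(1) unfolding regular_subspace_def by blast
  then show "q = p" by simp
qed

lemma
  assumes "regular_subspace S"
  shows proj_in: "proj S x \<in> S"
    and proj_orthogonal: "y \<in> S \<Longrightarrow> form (x - proj S x) y = 0"
proof -
  obtain p where "p \<in> S" "\<And>y. y \<in> S \<Longrightarrow> form (x - p) y = 0"
    using orthogonal_projection_exists[OF assms] by blast
  moreover from this have "proj S x = p" by (intro proj_eqI assms)
  ultimately show "proj S x \<in> S" "y \<in> S \<Longrightarrow> form (x - proj S x) y = 0" by auto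
qed

lemma proj_fixes_iff: "regular_subspace S \<Longrightarrow> proj S x = x \<longleftrightarrow> x \<in> S"
  using proj_in[of S x] proj_eqI[of S x x] by auto

lemma proj_idem: "regular_subspace S \<Longrightarrow> proj S (proj S x) = proj S x"
  by (simp add: proj_fixes_iff proj_in)

lemma selfadjoint_proj: "regular_subspace S \<Longrightarrow> selfadjoint (proj S)"
proof -
  assume S: "regular_subspace S"
  have "form (proj S x) y = form (proj S x) (proj S y)" for x y
  proof -
    have "form (proj S x) (y - proj S y) = 0"
      using proj_orthogonal[OF S proj_in[OF S], of y x] by (metis form_sym)
    then show ?thesis by (simp add: form_diff_right)
  qed
  then show ?thesis unfolding selfadjoint_def by (metis form_sym)
qed

text \<open>Self-adjoint idempotents and regular subspaces are the same thing.\<close>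
lemma selfadjoint_idempotent_proj:
  assumes A: "selfadjoint A" and idem: "\<And>x. A (A x) = A x"
  shows "regular_subspace (range A)" and "A = proj (range A)"
proof -
  have "cvec.subspace (range A)"
    unfolding cvec.subspace_def
  proof (intro conjI ballI allI)
    show "0 \<in> range A" using selfadjoint_scaleC[OF A, of 0 0] by (metis cvec.scale_zero_left rangeI)
  qed (auto simp flip: selfadjoint_add[OF A] selfadjoint_scaleC[OF A])
  moreover have "x = 0" if "x \<in> range A" "\<forall>y\<in>range A. form x y = 0" for x
  proof (rule form_nondegenerate)
    fix y
    have "form x y = form (A x) y" using that(1) idem by auto
    then show "form x y = 0" using that(2) by (simp add: selfadjointD[OF A])
  qed
  ultimately show reg: "regular_subspace (range A)"
    unfolding regular_subspace_def by blast
  show "A = proj (range A)"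
  proof
    fix x
    have "proj (range A) x = A x"
      using reg by (rule proj_eqI) (auto simp: form_diff_left selfadjointD[OF A] idem)
    then show "A x = proj (range A) x" by simp
  qed
qed

lemma proj_subset:
  assumes "regular_subspace S" "regular_subspace T"
  shows "S \<subseteq> T \<longleftrightarrow> (\<forall>x. proj T (proj S x) = proj S x)"
  using assms by (metis proj_fixes_iff proj_in subset_iff)

lemma proj_comp_subset:
  assumes "regular_subspace S" "regular_subspace T" "S \<subseteq> T"
  shows "proj S (proj T x) = proj S x"
  using assms
  by (intro form_eqI) (metis proj_subset selfadjointD selfadjoint_proj)

lemma add_self_eq_scaleC: "x + x = 2 *C x" for x :: "'v::complex_vector"
  using scaleC_add_left[of 1 1 x] by (simp add: scaleC_one)

text \<open>
  For \<open>x\<close> in \<open>S\<close>, applying the projection onto \<open>S\<close> to the hypothesis gives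
  \<open>proj S (proj T x) = x\<close>, and then the hypothesis itself reads \<open>x + proj T x = 2x\<close>.
\<close>
lemma proj_anticommutator:
  assumes S: "regular_subspace S" and T: "regular_subspace T"
    and eq: "\<And>x. proj S (proj T x) + proj T (proj S x) = 2 *C proj S x"
  shows "S \<subseteq> T"
proof
  fix x assume "x \<in> S"
  then have x: "proj S x = x" by (simp add: proj_fixes_iff[OF S])
  note S_simps = selfadjoint_add[OF selfadjoint_proj[OF S]] selfadjoint_scaleC[OF selfadjoint_proj[OF S]]
  have two: "2 *C y = y + y" for y :: 'a
    by (simp only: add_self_eq_scaleC)
  have halve: "y = z" if "y + y = z + z" for y z :: 'a
  proof -
    have "2 *C y = 2 *C z" using that by (simp only: two)
    then show ?thesis by simp
  qed
  have "proj S (proj T x) = x"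
    using arg_cong[OF eq[of x], of "proj S"] by - (rule halve, simp add: S_simps two proj_idem[OF S] x)
  then have "proj T x = x"
    using eq[of x] by (simp add: x two)
  then show "x \<in> T" by (simp add: proj_fixes_iff[OF T])
qed

lemma subspace_chain_length:
  fixes S :: "nat \<Rightarrow> 'a::complex_quadratic_space set"
  assumes sub: "\<And>i. i \<le> m \<Longrightarrow> cvec.subspace (S i)"
    and less: "\<And>i. i < m \<Longrightarrow> S i \<subset> S (Suc i)"
  shows "m \<le> cvec.dim (UNIV :: 'a set)"
proof -
  obtain F :: "'a set" where F: "finite F" "cvec.independent F" "cvec.span F = UNIV"
    by (rule complex_quadratic_space_finite_basis)
  interpret fd: finite_dimensional_vector_space scaleC F
    by unfold_locales (use F in auto)
  have "i \<le> cvec.dim (S i)" if "i \<le> m" for i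
    using that
  proof (induction i)
    case (Suc i)
    have "cvec.dim (S i) < cvec.dim (S (Suc i))"
      using Suc.prems less[of i] sub by (intro fd.dim_psubset) (simp add: cvec.span_eq_iff[THEN iffD2])
    then show ?case using Suc by simp
  qed simp
  then show ?thesis using fd.dim_subset_UNIV[of "S m"] fd.dim_UNIV fd.dimension_def
    by (metis le_trans order_refl)
qed

context
  fixes B :: "'a::complex_quadratic_space set"
  assumes B: "orthonormal_basis B"
begin

lemma orthonormal_basis_finite: "finite B"
proof -
  obtain F :: "'a set" where "finite F" "cvec.span F = UNIV"
    by (rule complex_quadratic_space_finite_basis)
  then show ?thesis
    using B cvec.independent_span_bound[of F B] by (simp add: orthonormal_basis_def)
qed

lemma orthonormal_basis_card: "card B = cvec.dim (UNIV :: 'a set)"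
  using B cvec.dim_eq_card[of B UNIV] by (simp add: orthonormal_basis_def)

lemma orthonormal_basis_expansion: "(\<Sum>b\<in>B. form x b *C b) = x"
proof (rule form_eqI)
  fix y
  have "y \<in> cvec.span B" using B by (simp add: orthonormal_basis_def)
  then show "form (\<Sum>b\<in>B. form x b *C b) y = form x y"
  proof (induction rule: cvec.span_induct_alt)
    case (step c b y)
    have "form (\<Sum>b\<in>B. form x b *C b) b = (\<Sum>e\<in>B. if e = b then form x b else 0)"
      unfolding form_sum_left using B step(1)
      by (intro sum.cong) (auto simp: orthonormal_basis_def form_scaleC_left)
    also have "\<dots> = form x b" using step(1) orthonormal_basis_finite by simp
    finally show ?case using step(2) by (simp add: form_add_right form_scaleC_right)
  qed simp
qed

lemma regular_subspace_span:
  assumes "C \<subseteq> B" shows "regular_subspace (cvec.span C)"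
  unfolding regular_subspace_def
proof (intro conjI ballI impI)
  fix x assume x: "x \<in> cvec.span C" "\<forall>y\<in>cvec.span C. form x y = 0"
  have "form x b = 0" if "b \<in> B" for b
  proof (cases "b \<in> C")
    case False
    from x(1) show ?thesis
    proof (induction rule: cvec.span_induct_alt)
      case (step c a y)
      then have "form a b = 0"
        using B \<open>b \<in> B\<close> False assms unfolding orthonormal_basis_def by fastforce
      then show ?case using step by (simp add: form_add_left form_scaleC_left)
    qed simp
  qed (use x in \<open>auto intro: cvec.span_base\<close>)
  then show "x = 0"
    using orthonormal_basis_expansion[of x] by simp
qed simp

text \<open>The tensor \<open>\<Sum>b\<in>B. b \<otimes> b\<close> represents the form, so a self-adjoint operator may be
  moved from one factor to the other.\<close>
lemma orthonormal_basis_transpose: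
  fixes F :: "'a \<Rightarrow> 'a \<Rightarrow> 'v::complex_vector"
  assumes M: "selfadjoint M"
    and F: "\<And>x y z. F (x + y) z = F x z + F y z" "\<And>c x z. F (c *C x) z = c *C F x z"
      "\<And>x y z. F x (y + z) = F x y + F x z" "\<And>c x z. F x (c *C z) = c *C F x z"
  shows "(\<Sum>b\<in>B. F b (M b)) = (\<Sum>b\<in>B. F (M b) b)"
proof -
  have sym: "form (M b) c = form (M c) b" for b c
    using selfadjointD[OF M, of b c] form_sym[of b "M c"] by simp
  have F0: "F 0 z = 0" "F z 0 = 0" for z
    using F(2)[of 0 0 z] F(4)[of z 0 0] by simp_all
  have F_sum: "F (\<Sum>i\<in>I. f i) z = (\<Sum>i\<in>I. F (f i) z)" "F z (\<Sum>i\<in>I. f i) = (\<Sum>i\<in>I. F z (f i))" for z I and f :: "'a \<Rightarrow> 'a"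
    by (induction I rule: infinite_finite_induct) (simp_all add: F F0)
  have "(\<Sum>b\<in>B. F b (M b)) = (\<Sum>b\<in>B. \<Sum>c\<in>B. form (M b) c *C F b c)"
    by (simp flip: F(4) F_sum(2) add: orthonormal_basis_expansion)
  also have "\<dots> = (\<Sum>c\<in>B. \<Sum>b\<in>B. form (M c) b *C F b c)"
    by (subst sum.swap) (simp only: sym)
  also have "\<dots> = (\<Sum>b\<in>B. F (M b) b)"
    by (simp flip: F(2) F_sum(1) add: orthonormal_basis_expansion)
  finally show ?thesis .
qed

end

section \<open>Eigenvectors\<close>

text \<open>
  An invariant subspace contains the eigencomponents of its elements: subtracting \<open>l k\<close> times the
  sum from its image under \<open>T\<close> removes the component of index \<open>k\<close> and rescales the
  others by nonzero factors. For the zero subspace this is linear independence of eigenvectors.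
\<close>
lemma eigenvector_sum_in_subspace:
  fixes T :: "'v::complex_vector \<Rightarrow> 'v" and v :: "'i \<Rightarrow> 'v"
  assumes T: "Vector_Spaces.linear scaleC scaleC T"
    and U: "cvec.subspace U" "\<And>u. u \<in> U \<Longrightarrow> T u \<in> U"
    and fin: "finite J"
  shows "\<lbrakk>\<And>j. j \<in> J \<Longrightarrow> T (v j) = l j *C v j; inj_on l J; (\<Sum>j\<in>J. v j) \<in> U; j \<in> J\<rbrakk>
    \<Longrightarrow> v j \<in> U"
  using fin
proof (induction J arbitrary: v j rule: finite_induct)
  case (insert k J)
  interpret T: Vector_Spaces.linear scaleC scaleC T by (rule T)
  let ?s = "\<Sum>j\<in>insert k J. v j"
  have "T ?s - l k *C ?s = (\<Sum>j\<in>insert k J. (l j - l k) *C v j)"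
    by (simp only: T.sum cvec.scale_sum_right sum_subtractf[symmetric])
      (rule sum.cong, auto simp: insert.prems(1) cvec.scale_left_diff_distrib)
  then have "(\<Sum>j\<in>J. (l j - l k) *C v j) = T ?s - l k *C ?s"
    using insert.hyps by simp
  then have "(\<Sum>j\<in>J. (l j - l k) *C v j) \<in> U"
    using insert.prems(3) U by (auto intro!: cvec.subspace_diff cvec.subspace_scale)
  then have *: "(l j - l k) *C v j \<in> U" if "j \<in> J" for j
    using that insert.prems
    by (intro insert.IH[where v = "\<lambda>j. (l j - l k) *C v j"])
       (auto simp: T.scale scaleC_scaleC mult.commute)
  have J: "v j \<in> U" if "j \<in> J" for j
  proof -
    have "l j \<noteq> l k" using insert.prems(2) insert.hyps(2) that by (auto simp: inj_on_def)
    moreover have "inverse (l j - l k) *C (l j - l k) *C v j \<in> U"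
      using *[OF that] U by (simp only: cvec.subspace_scale)
    ultimately show ?thesis by (simp add: scaleC_scaleC scaleC_one)
  qed
  have "v k = ?s - (\<Sum>j\<in>J. v j)" using insert.hyps by simp
  moreover have "(\<Sum>j\<in>J. v j) \<in> U" using J U by (simp add: cvec.subspace_sum)
  ultimately have "v k \<in> U" using insert.prems(3) U by (metis cvec.subspace_diff)
  then show ?case using J insert.prems(4) by auto
qed simp

section \<open>Identities in vertex algebras\<close>

context vertex_algebra
begin

lemma
  shows Y_add_left: "Y (u + u') n v = Y u n v + Y u' n v"
    and Y_scale_left: "Y (c *C u) n v = c *C Y u n v"
    and Y_zero_left: "Y 0 n v = 0"
    and Y_diff_left: "Y (u - u') n v = Y u n v - Y u' n v"
proof -
  interpret L: Vector_Spaces.linear scaleC scaleC "\<lambda>u. Y u n v" by (rule Y_linear_left)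
  show "Y (u + u') n v = Y u n v + Y u' n v" "Y (c *C u) n v = c *C Y u n v"
    "Y 0 n v = 0" "Y (u - u') n v = Y u n v - Y u' n v"
    by (rule L.add L.scale L.zero L.diff)+
qed

lemma
  shows Y_add_right: "Y u n (v + v') = Y u n v + Y u n v'"
    and Y_scale_right: "Y u n (c *C v) = c *C Y u n v"
    and Y_zero_right: "Y u n 0 = 0"
    and Y_sum_right: "Y u n (\<Sum>i\<in>I. f i) = (\<Sum>i\<in>I. Y u n (f i))"
proof -
  interpret L: Vector_Spaces.linear scaleC scaleC "Y u n" by (rule Y_linear_right)
  show "Y u n (v + v') = Y u n v + Y u n v'" "Y u n (c *C v) = c *C Y u n v"
    "Y u n 0 = 0" "Y u n (\<Sum>i\<in>I. f i) = (\<Sum>i\<in>I. Y u n (f i))"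
    by (rule L.add L.scale L.zero L.sum)+
qed

text \<open>The Borcherds identity with \<open>l = 0\<close>, where the right-hand sum has the single index \<open>0\<close>.\<close>
lemma commutator_formula:
  assumes "\<And>i. i \<ge> N \<Longrightarrow> Y u (int i) v = 0"
  shows "Y u m (Y v n w) = Y v n (Y u m w) +
    (\<Sum>i<N. (of_int m gchoose i) *C Y (Y u (int i) v) (m + n - int i) w)"
proof -
  have zero: "i \<ge> N \<Longrightarrow> Y (Y u (int i) v) k w = 0" for i k
    by (simp add: assms Y_zero_left)
  have "Sum_any (\<lambda>i::nat. (of_int m gchoose i) *C Y (Y u (0 + int i) v) (m + n - int i) w) =
      (\<Sum>i<N. (of_int m gchoose i) *C Y (Y u (int i) v) (m + n - int i) w)"
  proof (subst Sum_any.expand_superset[where A = "{..<N}"])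
    show "{i::nat. (of_int m gchoose i) *C Y (Y u (0 + int i) v) (m + n - int i) w \<noteq> 0} \<subseteq> {..<N}"
      using zero by (auto intro: leI simp: not_le[symmetric])
  qed simp_all
  moreover have "Sum_any (\<lambda>i::nat. ((-1) ^ i * (of_int 0 gchoose i)) *C
         (Y u (0 + m - int i) (Y v (n + int i) w)
           - ((-1) powi 0) *C Y v (0 + n - int i) (Y u (m + int i) w))) =
      Y u m (Y v n w) - Y v n (Y u m w)"
  proof (subst Sum_any.expand_superset[where A = "{0}"])
    show "{i::nat. ((-1) ^ i * (of_int 0 gchoose i)) *C
         (Y u (0 + m - int i) (Y v (n + int i) w)
           - ((-1) powi 0) *C Y v (0 + n - int i) (Y u (m + int i) w)) \<noteq> 0} \<subseteq> {0}"
      by (auto simp: gbinomial_0_left split: if_splits)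
  qed (simp_all add: scaleC_one)
  ultimately show ?thesis
    using borcherds[of m u 0 v n w] by (simp add: algebra_simps)
qed

definition translation :: "'v \<Rightarrow> 'v" where
  "translation u = Y u (-2) vac"

lemma gbinomial_minus_two: "(-1) ^ i * ((of_int (-2) :: complex) gchoose i) = of_nat (Suc i)"
proof -
  have "(of_nat (Suc i) :: complex) gchoose i = of_nat (Suc i)"
    using binomial_gbinomial[of "Suc i" i, where 'a = complex] by simp
  then show ?thesis
    using gbinomial_negated_upper[of "-2 :: complex" i]
    by (simp add: power_mult_distrib[symmetric] flip: mult.assoc)
qed

text \<open>
  The Borcherds identity with \<open>v\<close> the vacuum, \<open>l = -2\<close> and \<open>m = 0\<close>. The only mode of
  the vacuum that is nonzero has index \<open>-1\<close>, which selects one summand: in the first term for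
  negative \<open>n\<close>, in the second one for positive \<open>n\<close>.
\<close>
lemma Y_translation: "Y (translation u) n w = - (of_int n *C Y u (n - 1) w)"
proof -
  have lhs: "Sum_any (\<lambda>i::nat. (of_int 0 gchoose i) *C Y (Y u (-2 + int i) vac) (0 + n - int i) w) =
      Y (translation u) n w"
    by (subst Sum_any.expand_superset[where A = "{0}"])
      (auto simp: gbinomial_0_left translation_def scaleC_one split: if_splits)
  \<comment> \<open>for \<open>n = 0\<close> no summand survives, and \<open>?k\<close> takes the harmless value \<open>0\<close>\<close>
  let ?k = "nat (if n < 0 then - n - 1 else n - 1)"
  let ?r = "\<lambda>i::nat. ((-1) ^ i * (of_int (-2) gchoose i)) *C
         (Y u (-2 + 0 - int i) (Y vac (n + int i) w)
           - ((-1) powi (-2)) *C Y vac (-2 + n - int i) (Y u (0 + int i) w))"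
  have "Sum_any ?r = (\<Sum>i\<in>{?k}. ?r i)"
    by (rule Sum_any.expand_superset) (auto simp: vacuum Y_zero_right split: if_splits)
  also have "\<dots> = - (of_int n *C Y u (n - 1) w)"
    unfolding gbinomial_minus_two
    by (auto simp: vacuum Y_zero_right scaleC_one)
  finally show ?thesis
    using lhs borcherds[of 0 u "-2" vac n w] by simp
qed

text \<open>
  The Borcherds identity with \<open>w\<close> the vacuum, \<open>m = 0\<close> and \<open>n = -2\<close>. By the creation
  property only the indices \<open>0\<close> and \<open>1\<close> contribute.
\<close>
lemma translation_Y:
  "translation (Y u m v) = Y u m (translation v) - of_int m *C Y u (m - 1) v"
proof -
  have lhs: "Sum_any (\<lambda>i::nat. (of_int 0 gchoose i) *C Y (Y u (m + int i) v) (0 + -2 - int i) vac) =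
      translation (Y u m v)"
    by (subst Sum_any.expand_superset[where A = "{0}"])
      (auto simp: gbinomial_0_left translation_def scaleC_one split: if_splits)
  let ?r = "\<lambda>i::nat. ((-1) ^ i * (of_int m gchoose i)) *C
         (Y u (m + 0 - int i) (Y v (-2 + int i) vac)
           - ((-1) powi m) *C Y v (m + -2 - int i) (Y u (0 + int i) vac))"
  have "?r i = 0" if "i \<notin> {0, 1}" for i
    using that by (simp add: creation Y_zero_right)
  then have "Sum_any ?r = (\<Sum>i\<in>{0, 1}. ?r i)"
    by (intro Sum_any.expand_superset) auto
  also have "\<dots> = Y u m (translation v) - of_int m *C Y u (m - 1) v"
    by (simp add: creation Y_zero_right translation_def scaleC_one)
  finally show ?thesis
    using lhs borcherds[of 0 u m v "-2" vac] by simp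
qed

lemma translation_linear:
  "translation (u + v) = translation u + translation v" "translation (c *C u) = c *C translation u"
  by (simp_all add: translation_def Y_add_left Y_scale_left)

lemma translation_vacuum: "translation vac = 0"
  by (simp add: translation_def vacuum)

end

section \<open>Quadratic vectors\<close>

lemma emb_add: "emb (a + b) = emb a + emb b"
  by (simp add: emb_def mode_add_left)

lemma emb_scale: "emb (c *C a) = c *C emb a"
  by (simp add: emb_def mode_scale_left)

lemma mode_zero_left [simp]: "mode 0 n v = 0"
  using mode_scale_left[of 0 0 n v] by simp

lemma mode_zero_right [simp]: "mode a n 0 = 0"
  using mode_scale_right[of a n 0 0] by simp

lemma mode_diff_right: "mode a n (u - v) = mode a n u - mode a n v"
  using mode_add_right[of a n "u - v" v] by simp

lemma mode_minus_right: "mode a n (- v) = - mode a n v"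
  using mode_diff_right[of a n 0 v] by simp

lemma mode_sum_right: "mode a n (\<Sum>i\<in>I. f i) = (\<Sum>i\<in>I. mode a n (f i))"
  by (induction I rule: infinite_finite_induct) (simp_all add: mode_add_right)

lemma mode_sum_left: "mode (\<Sum>i\<in>I. f i) n v = (\<Sum>i\<in>I. mode (f i) n v)"
  by (induction I rule: infinite_finite_induct) (simp_all add: mode_add_left)

lemma emb_zero [simp]: "emb 0 = 0"
  by (simp add: emb_def)

lemma emb_sum: "emb (\<Sum>i\<in>I. f i) = (\<Sum>i\<in>I. emb (f i))"
  by (simp add: emb_def mode_sum_left)

lemma mode_emb: "n \<ge> 0 \<Longrightarrow> mode a n (emb b) = (if n = 1 then form a b else 0) *C vacuum"
  unfolding emb_def by (subst mode_commutator) (auto simp: mode_vacuum)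

text \<open>The form can be read off from the modes, because the vacuum is nonzero.\<close>
lemma inj_emb: "inj (emb :: 'a::complex_quadratic_space \<Rightarrow> 'a heis)"
proof (rule injI)
  fix a b :: 'a assume "emb a = emb b"
  then have "form c a *C (vacuum :: 'a heis) = form c b *C vacuum" for c
    using mode_emb[of 1 c a] mode_emb[of 1 c b] by (metis le_numeral_extra(1))
  then have "form c a = form c b" for c
    using vacuum_nonzero by (metis cvec.scale_cancel_right)
  then show "a = b"
    by (intro form_eqI) (metis form_sym)
qed

lemma emb_eq_iff [simp]: "emb a = emb b \<longleftrightarrow> a = b"
  by (rule inj_eq[OF inj_emb])

locale heisenberg =
  fixes Y :: "'a::complex_quadratic_space heis \<Rightarrow> int \<Rightarrow> 'a heis \<Rightarrow> 'a heis"
    and B :: "'a set"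
  assumes heis: "heisenberg_vertex_algebra Y"
    and onb: "orthonormal_basis B"

sublocale heisenberg \<subseteq> vertex_algebra Y vacuum
  using heis by (simp add: heisenberg_vertex_algebra_def)

context heisenberg
begin

lemma Y_emb: "Y (emb a) n v = mode a n v"
  using heis by (simp add: heisenberg_vertex_algebra_def)

definition quad :: "('a \<Rightarrow> 'a) \<Rightarrow> 'a \<Rightarrow> 'a heis" where
  "quad A a = (1 / 2) *C (\<Sum>b\<in>B. mode (A b) (-1) (emb b)) + mode a (-2) vacuum"

lemma conformal_vector_quad: "conformal_vector B h = quad (\<lambda>x. x) h"
  by (simp add: conformal_vector_def quad_def emb_def)

lemma quad_add: "quad (\<lambda>x. A x + A' x) (a + a') = quad A a + quad A' a'"
  by (simp add: quad_def mode_add_left sum.distrib scaleC_add_right)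

lemma quad_scale: "quad (\<lambda>x. c *C A x) (c *C a) = c *C quad A a"
  by (simp add: quad_def mode_scale_left scaleC_add_right scaleC_scaleC mult.commute
      flip: cvec.scale_sum_right)

lemma quad_zero: "quad (\<lambda>x. 0) 0 = 0"
  by (simp add: quad_def)

lemma quad_diff: "quad (\<lambda>x. A x - A' x) (a - a') = quad A a - quad A' a'"
  using quad_add[of "\<lambda>x. A x - A' x" A' "a - a'" a'] by simp

lemma mode_pair:
  "n \<ge> 0 \<Longrightarrow> mode a n (mode x (-1) (emb y)) = (if n = 1 then emb (form a x *C y + form a y *C x) else 0)"
  using mode_emb[of n a y]
  by (subst mode_commutator) (auto simp: mode_scale_right mode_add_left mode_scale_left emb_def add.commute)

lemma mode_quad:
  assumes A: "selfadjoint A" and "n \<ge> 0"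
  shows "mode a n (quad A c) =
    (if n = 1 then emb (A a) else if n = 2 then (2 * form a c) *C vacuum else 0)"
proof -
  have lin: "mode a n (mode c (-2) vacuum) = (if n = 2 then (2 * form a c) *C vacuum else 0)"
    using \<open>n \<ge> 0\<close> by (subst mode_commutator) (auto simp: mode_vacuum)
  show ?thesis
  proof (cases "n = 1")
    case True
    have "(\<Sum>b\<in>B. form a (A b) *C b) = A a"
      using orthonormal_basis_expansion[OF onb, of "A a"] by (simp add: selfadjointD[OF A])
    moreover have "(\<Sum>b\<in>B. form a b *C A b) = A a"
    proof -
      have "(\<Sum>b\<in>B. form a b *C A b) = (\<Sum>b\<in>B. form a (A b) *C b)"
        by (rule orthonormal_basis_transpose[OF onb A, of "\<lambda>x y. form a x *C y"])
          (simp_all add: form_add_right form_scaleC_right scaleC_add_left scaleC_add_right scaleC_scaleC mult.commute)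
      then show ?thesis using \<open>(\<Sum>b\<in>B. form a (A b) *C b) = A a\<close> by simp
    qed
    ultimately have "(\<Sum>b\<in>B. form a (A b) *C b + form a b *C A b) = 2 *C A a"
      using scaleC_add_left[of 1 1 "A a"] by (simp add: sum.distrib scaleC_one)
    then show ?thesis
      using True lin
      by (simp add: quad_def mode_add_right mode_scale_right mode_sum_right mode_pair scaleC_scaleC scaleC_one
        flip: emb_sum emb_scale)
  next
    case False
    then show ?thesis
      using \<open>n \<ge> 0\<close> lin
      by (simp add: quad_def mode_add_right mode_scale_right mode_sum_right mode_pair)
  qed
qed

text \<open>
  The commutator formula for the generator \<open>emb a\<close> with \<open>quad A c\<close>; by \<open>mode_quad\<close> only the products
  of index \<open>1\<close> and \<open>2\<close> contribute.
\<close>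
lemma quad_mode_commutator:
  assumes A: "selfadjoint A"
  shows "Y (quad A c) k (mode a m v) = mode a m (Y (quad A c) k v)
     - of_int m *C mode (A a) (m + k - 1) v
     - (if m + k = 1 then of_int m * (of_int m - 1) * form a c else 0) *C v"
proof -
  have N: "Y (emb a) (int i) (quad A c) = 0" if "i \<ge> 3" for i
    using that by (simp add: Y_emb mode_quad[OF A])
  have g2: "((of_int m :: complex) gchoose 2) * 2 = of_int m * (of_int m - 1)"
    by (simp add: gbinomial_prod_rev numeral_2_eq_2 mult.commute)
  have "mode a m (Y (quad A c) k v) = Y (quad A c) k (mode a m v) +
    (\<Sum>i<3. (of_int m gchoose i) *C Y (mode a (int i) (quad A c)) (m + k - int i) v)"
    using commutator_formula[of 3 "emb a" "quad A c" m k v, OF N] by (simp add: Y_emb)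
  also have "(\<Sum>i<3. (of_int m gchoose i) *C Y (mode a (int i) (quad A c)) (m + k - int i) v) =
     of_int m *C mode (A a) (m + k - 1) v
     + (if m + k = 1 then of_int m * (of_int m - 1) * form a c else 0) *C v"
    by (simp add: mode_quad[OF A] Y_zero_left Y_emb Y_scale_left vacuum eval_nat_numeral scaleC_scaleC
        flip: g2)
  finally show ?thesis by (simp only: diff_diff_eq add_diff_cancel_right')
qed

lemma quad_vacuum: "k \<ge> 0 \<Longrightarrow> Y (quad A c) k vacuum = 0"
  by (rule creation(1))

lemma quad_emb:
  assumes "selfadjoint A"
  shows "Y (quad A c) 1 (emb a) = emb (A a)"
    and "Y (quad A c) 2 (emb a) = (- 2 * form a c) *C vacuum"
  unfolding emb_def by (simp_all add: quad_mode_commutator[OF assms] quad_vacuum mode_vacuum)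

text \<open>
  A quadratic vector acts on a vector by commuting past the creation operators until it reaches
  the vacuum, which its modes of nonnegative index kill. This computes all products of quadratic
  vectors of nonnegative index.
\<close>
lemma quad_mode_creation:
  assumes "selfadjoint A" "k \<ge> 0"
  shows "Y (quad A c) k (mode x n vacuum) = - (of_int n *C mode (A x) (n + k - 1) vacuum)
     - (if n + k = 1 then of_int n * (of_int n - 1) * form x c else 0) *C vacuum"
  using assms by (simp add: quad_mode_commutator quad_vacuum)

lemma quad_pair:
  assumes A: "selfadjoint A" and "k \<ge> 0"
  shows "Y (quad A c) k (mode x (-1) (emb y)) =
     mode x (-1) (mode (A y) (k - 2) vacuum) + mode (A x) (k - 2) (mode y (-1) vacuum)
     - (if k = 2 then emb ((2 * form y c) *C x + (2 * form x c) *C y) else 0)"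
  using assms unfolding emb_def
  by (auto simp: quad_mode_commutator[OF A] quad_vacuum mode_diff_right mode_minus_right
      mode_scale_right mode_add_left mode_scale_left algebra_simps)

lemma quad_1_quad:
  assumes A: "selfadjoint A" and A': "selfadjoint A'"
  shows "Y (quad A a) 1 (quad A' a') = quad (\<lambda>x. A' (A x) + A (A' x)) (2 *C A a')"
proof -
  have "(\<Sum>b\<in>B. mode (A' b) (-1) (mode (A b) (-1) vacuum)) = (\<Sum>b\<in>B. mode (A' (A b)) (-1) (mode b (-1) vacuum))"
    by (rule orthonormal_basis_transpose[OF onb A, of "\<lambda>x y. mode (A' x) (-1) (mode y (-1) vacuum)"])
      (simp_all add: selfadjoint_add[OF A'] selfadjoint_scaleC[OF A'] mode_add_left mode_scale_left
        mode_add_right mode_scale_right)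
  then show ?thesis
    by (simp add: quad_def[of A'] Y_add_right Y_scale_right Y_sum_right quad_pair[OF A]
        quad_mode_creation[OF A] quad_def[of _ "2 *C A a'"] sum.distrib mode_add_left mode_scale_left
        scaleC_add_right) (simp add: emb_def)
qed

lemma quad_2_quad:
  assumes A: "selfadjoint A" and A': "selfadjoint A'"
  shows "Y (quad A a) 2 (quad A' a') = emb (2 *C (A a' - A' a))"
proof -
  have "(\<Sum>b\<in>B. form (A' b) a *C b) = A' a"
    using orthonormal_basis_expansion[OF onb, of "A' a"]
    by (simp add: selfadjointD[OF A'] form_sym[of _ "A' a"])
  moreover have "(\<Sum>b\<in>B. form b a *C A' b) = (\<Sum>b\<in>B. form (A' b) a *C b)"
    by (rule orthonormal_basis_transpose[OF onb A', of "\<lambda>x y. form x a *C y"])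
      (simp_all add: form_add_left form_scaleC_left scaleC_add_left scaleC_add_right scaleC_scaleC mult.commute)
  ultimately have *: "(\<Sum>b\<in>B. (2 * form b a) *C A' b + (2 * form (A' b) a) *C b) = 2 *C (2 *C A' a)"
    using scaleC_add_left[of 1 1 "2 *C A' a"]
    by (simp add: sum.distrib scaleC_one flip: scaleC_scaleC cvec.scale_sum_right)
  have "mode x 0 (mode y (-1) vacuum) = 0" for x y :: 'a
    by (subst mode_commutator) (simp add: mode_vacuum)
  then have "Y (quad A a) 2 (quad A' a') = (1/2) *C (- emb (2 *C (2 *C A' a))) + emb (2 *C A a')"
    by (simp add: quad_def[of A'] Y_add_right Y_scale_right Y_sum_right quad_pair[OF A]
        quad_mode_creation[OF A] mode_vacuum sum_negf * flip: emb_sum emb_scale) (simp add: emb_def emb_scale mode_scale_left)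
  also have "\<dots> = emb (2 *C (A a' - A' a))"
    using emb_add[of "2 *C (A a' - A' a)" "2 *C A' a"]
    by (simp add: emb_scale scaleC_scaleC scaleC_one cvec.scale_right_diff_distrib)
  finally show ?thesis .
qed

lemma quad_3_quad:
  assumes A: "selfadjoint A"
  shows "Y (quad A a) 3 (quad A' a') = ((\<Sum>b\<in>B. form (A (A' b)) b) / 2 - 6 * form a' a) *C vacuum"
proof -
  have "mode x 1 (mode y (-1) vacuum) = form x y *C vacuum" for x y :: 'a
    using mode_emb[of 1 x y] by (simp add: emb_def)
  then show ?thesis
    by (simp add: quad_def[of A'] Y_add_right Y_scale_right Y_sum_right quad_pair[OF A]
        quad_mode_creation[OF A] mode_vacuum scaleC_scaleC cvec.scale_left_diff_distrib flip: cvec.scale_sum_left)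
qed

lemma quad_ge4_quad:
  assumes A: "selfadjoint A" and "k \<ge> 4"
  shows "Y (quad A a) k (quad A' a') = 0"
proof -
  have "mode x (k - 2) (mode y (-1) vacuum) = 0" for x y :: 'a
    using mode_emb[of "k - 2" x y] \<open>k \<ge> 4\<close> by (simp add: emb_def)
  then show ?thesis
    using \<open>k \<ge> 4\<close>
    by (simp add: quad_def[of A'] Y_add_right Y_scale_right Y_sum_right quad_pair[OF A]
        quad_mode_creation[OF A] mode_vacuum)
qed

lemma quad_0_quad:
  assumes A: "selfadjoint A" and A': "selfadjoint A'"
  shows "Y (quad A a) 0 (quad A' a') =
    (1 / 2) *C (\<Sum>b\<in>B. mode (A' (A b)) (-1) (mode b (-2) vacuum) + mode (A (A' b)) (-2) (mode b (-1) vacuum))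
    + 2 *C mode (A a') (-3) vacuum"
proof -
  have "(\<Sum>b\<in>B. mode (A' b) (-1) (mode (A b) (-2) vacuum)) = (\<Sum>b\<in>B. mode (A' (A b)) (-1) (mode b (-2) vacuum))"
    by (rule orthonormal_basis_transpose[OF onb A, of "\<lambda>x y. mode (A' x) (-1) (mode y (-2) vacuum)"])
      (simp_all add: selfadjoint_add[OF A'] selfadjoint_scaleC[OF A'] mode_add_left mode_scale_left
        mode_add_right mode_scale_right)
  then show ?thesis
    by (simp add: quad_def[of A'] Y_add_right Y_scale_right Y_sum_right quad_pair[OF A]
        quad_mode_creation[OF A] sum.distrib)
qed

lemma quad_eqD:
  assumes "selfadjoint A" "selfadjoint A'" "quad A a = quad A' a'"
  shows "A = A'" "a = a'"
proof -
  have "emb (A u) = emb (A' u)" for u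
    using assms quad_emb(1)[of A a u] quad_emb(1)[of A' a' u] by simp
  then show "A = A'" by auto
  have "(- 2 * form u a) *C vacuum = (- 2 * form u a') *C (vacuum :: 'a heis)" for u
    using quad_emb(2)[OF assms(1), of a u] quad_emb(2)[OF assms(2), of a' u] assms(3) by metis
  then have "- 2 * form u a = - 2 * form u a'" for u
    using vacuum_nonzero by (metis cvec.scale_cancel_right)
  then have "form u a = form u a'" for u by simp
  then show "a = a'" by (intro form_eqI) (metis form_sym)
qed

end

section \<open>The grading by conformal weight\<close>

text \<open>The pair \<open>(b, n)\<close> stands for the creation operator \<open>b(-n)\<close>, when \<open>n \<ge> 1\<close>.\<close>
definition monomial :: "('a::complex_quadratic_space \<times> nat) list \<Rightarrow> 'a heis" where
  "monomial l = foldr (\<lambda>(b, n) v. mode b (- int n) v) l vacuum"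

definition weight :: "('a \<times> nat) list \<Rightarrow> nat" where
  "weight l = sum_list (map snd l)"

context heisenberg
begin

lemma conformal_mode_commutator:
  "Y (conformal_vector B h) 1 (mode a m v) =
     mode a m (Y (conformal_vector B h) 1 v) - of_int m *C mode a m v"
  "Y (conformal_vector B h) 0 (mode a m v) =
     mode a m (Y (conformal_vector B h) 0 v) - of_int m *C mode a (m - 1) v"
  by (simp_all add: conformal_vector_quad quad_mode_commutator[OF selfadjoint_id])

text \<open>Both sides kill the vacuum and have the same commutators with the generators.\<close>
lemma conformal_0_translation: "Y (conformal_vector B h) 0 v = translation v"
proof (induction v rule: heis_mode_induct)
  case vacuum
  show ?case by (simp add: creation translation_vacuum)
next
  case (mode a n v)
  then show ?case
    using translation_Y[of "emb a" n v] by (simp add: conformal_mode_commutator Y_emb)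
qed (simp_all add: translation_linear Y_add_right Y_scale_right)

definition monomials :: "nat \<Rightarrow> 'a heis set" where
  "monomials k = monomial ` {l. set l \<subseteq> B \<times> {1..} \<and> weight l = k}"

text \<open>Every factor contributes at least one to the weight, which bounds both length and entries.\<close>
lemma finite_monomials: "finite (monomials k)"
proof -
  have len: "length l \<le> weight l" if "set l \<subseteq> B \<times> {1..}" for l
    using that by (induction l) (auto simp: weight_def)
  have bound: "set l \<subseteq> B \<times> {..weight l}" if "set l \<subseteq> B \<times> {1..}" for l
  proof
    fix x assume x: "x \<in> set l"
    have "snd x \<le> weight l" using x unfolding weight_def by (intro member_le_sum_list) auto
    then show "x \<in> B \<times> {..weight l}" using x that by (cases x) auto
  qed
  have "{l. set l \<subseteq> B \<times> {1..} \<and> weight l = k} \<subseteq> {l. set l \<subseteq> B \<times> {..k} \<and> length l \<le> k}"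
    using len bound by blast
  then have "finite {l. set l \<subseteq> B \<times> {1..} \<and> weight l = k}"
    by (rule finite_subset)
      (simp add: finite_lists_length_le orthonormal_basis_finite[OF onb])
  then show ?thesis by (simp add: monomials_def)
qed

lemma monomial_eigenvector:
  "Y (conformal_vector B h) 1 (monomial l) = of_nat (weight l) *C monomial l"
proof (induction l)
  case Nil
  show ?case by (simp add: monomial_def weight_def creation)
next
  case (Cons x l)
  obtain b n where x: "x = (b, n)" by (cases x)
  have "monomial (x # l) = mode b (- int n) (monomial l)" "weight (x # l) = n + weight l"
    by (simp_all add: monomial_def weight_def x)
  then show ?case
    by (simp add: Cons conformal_mode_commutator mode_scale_right scaleC_add_left)
qed

text \<open>
  Creation operators lengthen a monomial. An annihilation operator is commuted to the right until
  it reaches the vacuum, each commutator being a scalar.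
\<close>
lemma mode_span_monomials:
  assumes "v \<in> cvec.span (monomial ` {l. set l \<subseteq> B \<times> {1..}})" (is "v \<in> ?X")
  shows "mode a n v \<in> ?X"
proof -
  have expand: "mode a n v = (\<Sum>b\<in>B. form a b *C mode b n v)" for a n and v
    by (simp flip: mode_scale_left mode_sum_left add: orthonormal_basis_expansion[OF onb])
  have create: "mode a (- int n) v \<in> ?X" if v: "v \<in> ?X" and n: "n \<ge> 1" for a n v
  proof -
    have "mode b (- int n) v \<in> ?X" if b: "b \<in> B" for b
      using v
    proof (induction rule: cvec.span_induct_alt)
      case base
      show ?case by (simp add: cvec.span_zero)
    next
      case (step c x y)
      then obtain l where l: "x = monomial l" "set l \<subseteq> B \<times> {1..}" by auto
      have "mode b (- int n) x = monomial ((b, n) # l)" by (simp add: l monomial_def)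
      then have "mode b (- int n) x \<in> ?X"
        using b n l(2) by (auto intro!: cvec.span_base)
      then show ?case
        using step by (simp add: mode_add_right mode_scale_right cvec.span_add cvec.span_scale)
    qed
    then show ?thesis
      by (subst expand) (auto intro!: cvec.span_sum cvec.span_scale)
  qed
  have "mode a n (monomial l) \<in> ?X" if "set l \<subseteq> B \<times> {1..}" for l
    using that
  proof (induction l)
    case Nil
    have "vacuum \<in> ?X"
      by (rule cvec.span_base, rule image_eqI[of _ _ "[]"]) (simp_all add: monomial_def)
    then show ?case
      using create[of vacuum "nat (- n)" a]
      by (cases "n \<ge> 0") (simp_all add: monomial_def mode_vacuum cvec.span_zero)
  next
    case (Cons x l)
    obtain b m where x: "x = (b, m)" by (cases x)
    have "monomial (x # l) = mode b (- int m) (monomial l)" by (simp add: monomial_def x)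
    moreover have "mode b (- int m) (mode a n (monomial l)) \<in> ?X"
      using Cons x by (intro create) auto
    moreover have "monomial l \<in> ?X" using Cons by (auto intro!: cvec.span_base)
    ultimately show ?case
      by (simp only: mode_commutator[of a n b]) (intro cvec.span_add cvec.span_scale)
  qed
  note monomial = this
  from assms show ?thesis
  proof (induction rule: cvec.span_induct_alt)
    case base
    show ?case by (simp add: cvec.span_zero)
  next
    case (step c x y)
    then have "mode a n x \<in> ?X" using monomial by blast
    with step show ?case
      by (simp only: mode_add_right mode_scale_right) (intro cvec.span_add cvec.span_scale)
  qed
qed

lemma span_monomials: "cvec.span (monomial ` {l. set l \<subseteq> B \<times> {1..}}) = UNIV" (is "?X = _")
proof -
  have "v \<in> ?X" for v
  proof (induction v rule: heis_mode_induct)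
    case vacuum
    show ?case
      by (rule cvec.span_base, rule image_eqI[of _ _ "[]"]) (simp_all add: monomial_def)
  next
    case (mode a n v)
    then show ?case by (rule mode_span_monomials)
  qed (rule cvec.span_add cvec.span_scale; assumption)+
  then show ?thesis by blast
qed

text \<open>
  In the induction the identity is carried for all large numbers of summands, so that two
  decompositions can be added without aligning their lengths.
\<close>
lemma weight_decomposition:
  obtains f N where "\<And>j. f j \<in> cvec.span (monomials j)" "v = (\<Sum>j<N. f j)"
proof -
  have "v \<in> cvec.span (monomial ` {l. set l \<subseteq> B \<times> {1..}})" by (simp only: span_monomials UNIV_I)
  then have "\<exists>f. (\<forall>j. f j \<in> cvec.span (monomials j)) \<and> (\<exists>N. \<forall>M\<ge>N. v = (\<Sum>j<M. f j))"
  proof (induction rule: cvec.span_induct_alt)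
    case base
    show ?case by (rule exI[of _ "\<lambda>_. 0"]) (simp add: cvec.span_zero)
  next
    case (step c x y)
    then obtain f N l where f: "\<And>j. f j \<in> cvec.span (monomials j)" "\<And>M. M \<ge> N \<Longrightarrow> y = (\<Sum>j<M. f j)"
      and l: "x = monomial l" "set l \<subseteq> B \<times> {1..}" by auto
    let ?g = "\<lambda>j. (if j = weight l then c *C x else 0) + f j"
    have "monomial l \<in> cvec.span (monomials (weight l))"
      by (rule cvec.span_base) (use l in \<open>auto simp: monomials_def\<close>)
    then have "?g j \<in> cvec.span (monomials j)" for j
      using f by (auto simp: l intro!: cvec.span_add cvec.span_scale)
    moreover have "c *C x + y = (\<Sum>j<M. ?g j)" if "M \<ge> max N (Suc (weight l))" for M
      using f(2)[of M] that by (simp add: sum.distrib)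
    ultimately show ?case by (intro exI[of _ ?g] conjI allI exI[of _ "max N (Suc (weight l))"] impI)
  qed
  then show ?thesis using that by blast
qed

lemma span_monomials_eigenvector:
  assumes "v \<in> cvec.span (monomials k)"
  shows "Y (conformal_vector B h) 1 v = of_nat k *C v"
  using assms
  by (induction rule: cvec.span_induct_alt)
    (auto simp: monomials_def monomial_eigenvector Y_add_right Y_scale_right Y_zero_right
      scaleC_add_right scaleC_scaleC mult.commute)

text \<open>
  The weight components of an eigenvector are eigenvectors with distinct eigenvalues, so only one
  of them is nonzero.
\<close>
lemma weight_space:
  "{v. Y (conformal_vector B h) 1 v = of_int k *C v} =
    (if k \<ge> 0 then cvec.span (monomials (nat k)) else {0})"
proof (intro equalityI subsetI)
  let ?T = "Y (conformal_vector B h) 1"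
  fix v assume "v \<in> {v. ?T v = of_int k *C v}"
  then have v: "?T v = of_int k *C v" by simp
  obtain f N where f: "\<And>j. f j \<in> cvec.span (monomials j)" "v = (\<Sum>j<N. f j)"
    using weight_decomposition[of v] by blast
  have eig: "?T (f j) = of_nat j *C f j" for j
    using f(1) by (rule span_monomials_eigenvector)
  have "(of_nat j - of_int k) *C f j = 0" if "j < N" for j
  proof -
    have "(\<Sum>j<N. (of_nat j - of_int k) *C f j) = ?T v - of_int k *C v"
      by (simp add: f(2) Y_sum_right eig cvec.scale_left_diff_distrib sum_subtractf cvec.scale_sum_right)
    then have "(of_nat j - of_int k) *C f j \<in> {0}"
      using eigenvector_sum_in_subspace[of ?T "{0}" "{..<N}" "\<lambda>j. (of_nat j - of_int k) *C f j" of_nat j]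
        that
      by (simp add: v Y_linear_right Y_zero_right Y_scale_right eig scaleC_scaleC mult.commute
          inj_on_def cvec.subspace_single_0)
    then show ?thesis by simp
  qed
  then have zero: "f j = 0" if "j < N" "int j \<noteq> k" for j
    using that by (metis cvec.scale_eq_0_iff of_int_of_nat_eq of_int_eq_iff eq_iff_diff_eq_0)
  show "v \<in> (if k \<ge> 0 then cvec.span (monomials (nat k)) else {0})"
  proof (cases "k \<ge> 0")
    case True
    have "v = (\<Sum>j<N. if j = nat k then f j else 0)"
      unfolding f(2) by (rule sum.cong) (use zero True in auto)
    then show ?thesis using True f(1)[of "nat k"] by (auto simp: cvec.span_zero)
  next
    case False
    then show ?thesis using zero f(2) by simp
  qed
next
  fix v assume "v \<in> (if k \<ge> 0 then cvec.span (monomials (nat k)) else {0})"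
  then show "v \<in> {v. Y (conformal_vector B h) 1 v = of_int k *C v}"
    using span_monomials_eigenvector[of v "nat k" h] by (auto simp: Y_zero_right split: if_splits)
qed

lemma weight_one:
  assumes "Y (conformal_vector B h) 1 v = v"
  obtains a where "v = emb a"
proof -
  have "v \<in> {v. Y (conformal_vector B h) 1 v = of_int 1 *C v}"
    using assms by (simp add: scaleC_one)
  then have "v \<in> cvec.span (monomials 1)" by (simp only: weight_space) simp
  then have "\<exists>a. v = emb a"
  proof (induction rule: cvec.span_induct_alt)
    case base
    show ?case by (metis emb_zero)
  next
    case (step c x y)
    then obtain l a where l: "x = monomial l" "set l \<subseteq> B \<times> {1..}" "weight l = 1" and a: "y = emb a"
      by (auto simp: monomials_def)
    obtain b where "l = [(b, 1)]"
    proof (cases l)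
      case (Cons p l')
      then have "l' = []" using l(2,3) by (cases l') (auto simp: weight_def)
      then show ?thesis using that[of "fst p"] Cons l(3) by (cases p) (simp add: weight_def)
    qed (use l in \<open>simp add: weight_def\<close>)
    then have "x = emb b" by (simp add: l monomial_def emb_def)
    then show ?case using a by (metis emb_add emb_scale)
  qed
  then show ?thesis using that by blast
qed

lemma selfadjoint_linear_combination:
  "selfadjoint A \<Longrightarrow> selfadjoint A' \<Longrightarrow> selfadjoint (\<lambda>x. c *C A x + A' x)"
  by (simp add: selfadjoint_def form_add_left form_add_right form_scaleC_left form_scaleC_right)

text \<open>
  The monomials of weight two are \<open>b(-2) \<one>\<close> and \<open>b(-1) b'(-1) \<one>\<close>. The latter is the
  quadratic vector of the rank-two operator that symmetrizes \<open>b \<otimes> b'\<close>.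
\<close>
lemma weight_two:
  assumes "Y (conformal_vector B h) 1 v = 2 *C v"
  obtains A a where "selfadjoint A" "v = quad A a"
proof -
  have "v \<in> {v. Y (conformal_vector B h) 1 v = of_int 2 *C v}"
    using assms by simp
  then have "v \<in> cvec.span (monomials 2)" by (simp only: weight_space) simp
  then have "\<exists>A a. selfadjoint A \<and> v = quad A a"
  proof (induction rule: cvec.span_induct_alt)
    case base
    show ?case using quad_zero by (intro exI[of _ "\<lambda>_. 0"] exI[of _ 0]) (simp add: selfadjoint_def)
  next
    case (step c x y)
    then obtain l A a where l: "x = monomial l" "set l \<subseteq> B \<times> {1..}" "weight l = 2"
      and A: "selfadjoint A" "y = quad A a"
      by (auto simp: monomials_def)
    have "\<exists>A' a'. selfadjoint A' \<and> x = quad A' a'"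
    proof -
      consider b where "l = [(b, 2)]" | b b' where "l = [(b, 1), (b', 1)]"
      proof (cases l)
        case (Cons p l')
        show ?thesis
        proof (cases l')
          case Nil
          then show ?thesis using that(1)[of "fst p"] Cons l(3) by (cases p) (simp add: weight_def)
        next
          case (Cons q l'')
          have "l'' = []" using l(2,3) \<open>l = p # l'\<close> Cons by (cases l'') (auto simp: weight_def)
          moreover have "snd p = 1" "snd q = 1" using l(2,3) \<open>l = p # l'\<close> Cons by (auto simp: weight_def)
          ultimately show ?thesis using that(2)[of "fst p" "fst q"] \<open>l = p # l'\<close> Cons
            by (cases p, cases q) simp
        qed
      qed (use l in \<open>simp add: weight_def\<close>)
      then show ?thesis
      proof cases
        case 1
        then have "x = quad (\<lambda>_. 0) b" by (simp add: l monomial_def quad_def)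
        then show ?thesis by (intro exI[of _ "\<lambda>_. 0"] exI[of _ b]) (simp add: selfadjoint_def)
      next
        case 2
        let ?A = "\<lambda>u. form b u *C b' + form b' u *C b"
        have sum: "(\<Sum>e\<in>B. form p e *C mode q (-1) (emb e)) = mode q (-1) (emb p)" for p q
          by (simp add: orthonormal_basis_expansion[OF onb] flip: mode_scale_right mode_sum_right emb_scale emb_sum)
        have "mode b' (-1) (emb b) = mode b (-1) (emb b')"
          unfolding emb_def by (subst mode_commutator) simp
        then have "x = quad ?A 0"
          using scaleC_add_left[of "1/2" "1/2" x] scaleC_one[of x]
          by (simp add: l 2 monomial_def quad_def mode_add_left mode_scale_left sum.distrib sum
              scaleC_add_right flip: emb_def)
        moreover have "selfadjoint ?A"
          by (simp add: selfadjoint_def form_add_left form_add_right form_scaleC_left form_scaleC_right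
              form_sym mult.commute)
        ultimately show ?thesis by blast
      qed
    qed
    then obtain A' a' where A': "selfadjoint A'" "x = quad A' a'" by blast
    have "c *C x + y = quad (\<lambda>x. c *C A' x + A x) (c *C a' + a)"
      by (simp add: quad_add quad_scale A A')
    then show ?case using selfadjoint_linear_combination[OF A'(1) A(1)] by blast
  qed
  then show ?thesis using that by blast
qed

section \<open>Semi-conformal vectors\<close>

text \<open>
  Since \<open>w = L(-2) \<one>\<close>, the relations for \<open>[L(0), L(-2)]\<close> and \<open>[L(1), L(-2)]\<close>, applied to the
  vacuum, give \<open>L(0) w = 2w\<close> and \<open>L(1) w = 3 L(-1) \<one> = 0\<close>.
\<close>
lemma semiconformal_imp_equations:
  assumes "w \<in> Sc Y vacuum \<omega>"
  shows "Y \<omega> 1 w = 2 *C w" "Y \<omega> 2 w = 0" "Y w 1 w = 2 *C w"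
proof -
  obtain U where U: "vertex_operator_subalgebra Y vacuum U w"
    and agree: "\<And>n v. n \<ge> 0 \<Longrightarrow> v \<in> U \<Longrightarrow> Y \<omega> n v = Y w n v"
    using assms by (auto simp: Sc_def)
  have vac: "vacuum \<in> U" and wU: "w \<in> U"
    using U by (simp_all add: vertex_operator_subalgebra_def)
  have
    "\<exists>c. \<forall>m n. \<forall>v\<in>U. Vir Y w m (Vir Y w n v) - Vir Y w n (Vir Y w m v) =
        of_int (m - n) *C Vir Y w (m + n) v
        + (if m + n = 0 then (of_int (m ^ 3 - m) / 12 * c) *C v else 0)"
    using U unfolding vertex_operator_subalgebra_def by (elim conjE) assumption
  then obtain c where vir: "\<And>m n v. v \<in> U \<Longrightarrow> Vir Y w m (Vir Y w n v) - Vir Y w n (Vir Y w m v) =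
        of_int (m - n) *C Vir Y w (m + n) v
        + (if m + n = 0 then (of_int (m ^ 3 - m) / 12 * c) *C v else 0)"
    by metis
  show "Y w 1 w = 2 *C w"
    using vir[OF vac, of 0 "-2"] by (simp add: Vir_def creation Y_zero_right)
  then show "Y \<omega> 1 w = 2 *C w" using agree wU by simp
  have "Y w 2 w = 0"
    using vir[OF vac, of 1 "-2"] by (simp add: Vir_def creation Y_zero_right)
  then show "Y \<omega> 2 w = 0" using agree wU by simp
qed

text \<open>
  Comparing \<open>quad_1_quad\<close> and \<open>quad_2_quad\<close> with the hypotheses: \<open>w\<^sub>1 w = 2w\<close> reads
  \<open>2A\<^sup>2 = 2A\<close>, and \<open>\<omega>\<^sub>2 w = 0\<close> reads \<open>a = A h\<close>.
\<close>
lemma equations_imp_projection: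
  assumes "Y (conformal_vector B h) 1 w = 2 *C w" "Y (conformal_vector B h) 2 w = 0" "Y w 1 w = 2 *C w"
  obtains S where "regular_subspace S" "w = quad (proj S) (proj S h)"
proof -
  obtain A a where A: "selfadjoint A" and w: "w = quad A a"
    using weight_two[OF assms(1)] by blast
  have "quad (\<lambda>x. A (A x) + A (A x)) (2 *C A a) = quad (\<lambda>x. 2 *C A x) (2 *C a)"
    using assms(3) by (simp add: w quad_1_quad[OF A A] quad_scale)
  moreover have "selfadjoint (\<lambda>x. A (A x) + A (A x))" "selfadjoint (\<lambda>x. 2 *C A x)"
    using A by (simp_all add: selfadjoint_def form_add_left form_add_right form_scaleC_left form_scaleC_right)
  ultimately have "(\<lambda>x. A (A x) + A (A x)) = (\<lambda>x. 2 *C A x)"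
    using quad_eqD(1) by blast
  then have idem: "A (A x) = A x" for x
    by (simp add: fun_eq_iff add_self_eq_scaleC)
  have "emb (2 *C (a - A h)) = 0"
    using assms(2) quad_2_quad[OF selfadjoint_id A, of h a] by (simp add: conformal_vector_quad w)
  then have "2 *C (a - A h) = 0" by (metis emb_eq_iff emb_zero)
  then have "a = A h" by simp
  then show ?thesis
    using that selfadjoint_idempotent_proj[OF A idem] w by metis
qed

text \<open>
  The subalgebra is \<open>U\<close>, the vectors killed by all \<open>t\<^sub>n\<close> with \<open>n \<ge> 0\<close>, where \<open>t = \<omega> - w\<close> is the
  quadratic vector of the complementary projection. It is closed under products by
  the commutator formula, and contains \<open>w\<close> because complementary projections annihilate each
  other. The Virasoro relations follow from the products \<open>w\<^sub>i w\<close>; the other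
  properties hold for \<open>\<omega>\<close> and pass to \<open>w\<close> because the two agree on \<open>U\<close>.
\<close>
lemma projection_semiconformal:
  assumes S: "regular_subspace S"
  shows "quad (proj S) (proj S h) \<in> Sc Y vacuum (conformal_vector B h)"
proof -
  define P where "P = proj S"
  define w where "w = quad P (P h)"
  define \<omega> where "\<omega> = conformal_vector B h"
  define t where "t = \<omega> - w"
  define U where "U = {v. \<forall>n\<ge>0. Y t n v = 0}"
  have P: "selfadjoint P" and idem: "\<And>x. P (P x) = P x"
    by (simp_all add: P_def selfadjoint_proj[OF S] proj_idem[OF S])
  have P0: "P 0 = 0" using selfadjoint_scaleC[OF P, of 0 0] by simp
  have P_diff: "P (x - y) = P x - P y" for x y
    using selfadjoint_add[OF P, of "x - y" y] by simp
  have Q: "selfadjoint (\<lambda>x. x - P x)"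
    using P by (simp add: selfadjoint_def form_diff_left form_diff_right)
  have t: "t = quad (\<lambda>x. x - P x) (h - P h)"
    by (simp add: t_def \<omega>_def w_def conformal_vector_quad quad_diff)
  have t_w: "Y t n w = 0" if "n \<ge> 0" for n
  proof -
    consider "n = 0" | "n = 1" | "n = 2" | "n = 3" | "n \<ge> 4" using \<open>n \<ge> 0\<close> by linarith
    then show ?thesis
    proof cases
      case 4
      have "form (P h) (h - P h) = 0"
        using idem by (simp add: selfadjointD[OF P] P_diff form_diff_right)
      then show ?thesis using 4 by (simp add: t w_def quad_3_quad[OF Q] idem)
    qed (simp_all add: t w_def quad_0_quad[OF Q P] quad_1_quad[OF Q P] quad_2_quad[OF Q P]
        quad_ge4_quad[OF Q] idem P_diff quad_zero)
  qed
  have agree: "Y \<omega> n v = Y w n v" if "n \<ge> 0" "v \<in> U" for n v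
    using that by (simp add: U_def t_def Y_diff_left)
  have sub: "cvec.subspace U"
    by (auto simp: cvec.subspace_def U_def Y_zero_right Y_add_right Y_scale_right)
  have vac: "vacuum \<in> U" by (simp add: U_def creation)
  have w: "w \<in> U" by (simp add: U_def t_w)
  have closed: "Y u n v \<in> U" if "u \<in> U" "v \<in> U" for u v n
  proof -
    have "Y t m (Y u n v) = 0" if "m \<ge> 0" for m
      using commutator_formula[of 0 t u m n v] \<open>u \<in> U\<close> \<open>v \<in> U\<close> that
      by (simp add: U_def Y_zero_right)
    then show ?thesis by (simp add: U_def)
  qed
  have w0: "Y w 0 w = translation w"
    using agree[OF _ w, of 0] by (simp add: \<omega>_def conformal_0_translation)
  have w1: "Y w 1 w = 2 *C w"
  proof -
    have "quad (\<lambda>x. P x + P x) (2 *C P h) = quad (\<lambda>x. 2 *C P x) (2 *C P h)"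
      by (rule arg_cong[where f = "\<lambda>A. quad A _"]) (simp only: add_self_eq_scaleC)
    then show ?thesis by (simp add: w_def quad_1_quad[OF P P] idem quad_scale)
  qed
  have w2: "Y w 2 w = 0" by (simp add: w_def quad_2_quad[OF P P])
  define c where "c = (\<Sum>b\<in>B. form (P b) b) - 12 * form (P h) (P h)"
  have w3: "Y w 3 w = (c / 2) *C vacuum"
    by (simp add: w_def quad_3_quad[OF P] idem c_def diff_divide_distrib)
  have w4: "Y w (int i) w = 0" if "i \<ge> 4" for i
    using that by (simp add: w_def quad_ge4_quad[OF P])
  have virasoro: "Vir Y w m (Vir Y w n v) - Vir Y w n (Vir Y w m v) =
        of_int (m - n) *C Vir Y w (m + n) v
        + (if m + n = 0 then (of_int (m ^ 3 - m) / 12 * c) *C v else 0)" for m n v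
  proof -
    have g3: "(of_int (m + 1) :: complex) gchoose 3 = of_int (m ^ 3 - m) / 6"
      by (simp add: gbinomial_prod_rev eval_nat_numeral algebra_simps)
    have "m + n + 2 - 1 = m + n + 1" by simp
    then have t0: "Y (Y w 0 w) (m + n + 2) v = - (of_int (m + n + 2) *C Y w (m + n + 1) v)"
      by (simp only: w0 Y_translation)
    have t3: "(of_int (m + 1) gchoose 3) *C Y (Y w 3 w) (m + n - 1) v =
        (if m + n = 0 then (of_int (m ^ 3 - m) / 12 * c) *C v else 0)"
      by (simp add: w3 Y_scale_left vacuum scaleC_scaleC g3 del: of_int_add of_int_diff)
    have coeff: "(of_int (m + 1) * 2 :: complex) - of_int (m + n + 2) = of_int (m - n)"
      by simp
    have "Y w (m + 1) (Y w (n + 1) v) - Y w (n + 1) (Y w (m + 1) v) =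
        (\<Sum>i<4. (of_int (m + 1) gchoose i) *C Y (Y w (int i) w) (m + 1 + (n + 1) - int i) v)"
      using commutator_formula[of 4 w w "m + 1" "n + 1" v, OF w4] by simp
    also have "\<dots> = Y (Y w 0 w) (m + n + 2) v + (of_int (m + 1)) *C Y (Y w 1 w) (m + n + 1) v
        + (of_int (m + 1) gchoose 2) *C Y (Y w 2 w) (m + n) v
        + (of_int (m + 1) gchoose 3) *C Y (Y w 3 w) (m + n - 1) v"
      by (simp add: eval_nat_numeral scaleC_one algebra_simps)
    also have "\<dots> = ((of_int (m + 1) * 2) *C Y w (m + n + 1) v - of_int (m + n + 2) *C Y w (m + n + 1) v)
        + (if m + n = 0 then (of_int (m ^ 3 - m) / 12 * c) *C v else 0)"
      unfolding t0 t3 by (simp add: w1 w2 Y_scale_left Y_zero_left scaleC_scaleC)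
    also have "\<dots> = of_int (m - n) *C Y w (m + n + 1) v
        + (if m + n = 0 then (of_int (m ^ 3 - m) / 12 * c) *C v else 0)"
      by (simp only: coeff flip: cvec.scale_left_diff_distrib)
    finally show ?thesis by (simp add: Vir_def add.assoc)
  qed
  have derivative: "Y (Vir Y w (-1) u) n v = - (of_int n *C Y u (n - 1) v)" if "u \<in> U" for u v n
    using agree[OF _ that, of 0] conformal_0_translation[of h u] Y_translation[of u n v]
    by (simp add: Vir_def \<omega>_def)
  have weight: "{v\<in>U. Vir Y w 0 v = of_int k *C v} = {v\<in>U. Y \<omega> 1 v = of_int k *C v}" for k
    using agree[of 1] by (auto simp: Vir_def)
  have spanned: "U = cvec.span (\<Union>k::int. {v\<in>U. Vir Y w 0 v = of_int k *C v})" (is "U = cvec.span ?E")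
  proof (intro equalityI subsetI)
    fix v assume v: "v \<in> U"
    obtain f N where f: "\<And>j. f j \<in> cvec.span (monomials j)" "v = (\<Sum>j<N. f j)"
      using weight_decomposition[of v] by blast
    have eig: "Y \<omega> 1 (f j) = of_nat j *C f j" for j
      unfolding \<omega>_def using f(1) by (rule span_monomials_eigenvector)
    have stable: "Y \<omega> 1 u \<in> U" if "u \<in> U" for u
      using agree[OF _ that, of 1] closed[OF w that] by simp
    have "f j \<in> U" if "j < N" for j
      using eigenvector_sum_in_subspace[OF Y_linear_right sub stable, of "{..<N}" f of_nat j] v f(2) eig that
      by (simp add: inj_on_def)
    then have "f j \<in> {v\<in>U. Vir Y w 0 v = of_int (int j) *C v}" if "j < N" for j
      using that eig[of j] unfolding weight by simp
    then have "f j \<in> ?E" if "j < N" for j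
      using that by blast
    then show "v \<in> cvec.span ?E"
      unfolding f(2) by (intro cvec.span_sum cvec.span_base) auto
  next
    fix v assume "v \<in> cvec.span ?E"
    moreover have "cvec.span ?E \<subseteq> U" by (rule cvec.span_minimal) (auto simp: sub)
    ultimately show "v \<in> U" by blast
  qed
  have fin: "\<exists>E. finite E \<and> cvec.span E = {v\<in>U. Vir Y w 0 v = of_int k *C v}" for k :: int
  proof -
    let ?V = "{v\<in>U. Y \<omega> 1 v = of_int k *C v}"
    have V: "cvec.subspace ?V"
      using sub by (auto simp: cvec.subspace_def Y_zero_right Y_add_right Y_scale_right
          scaleC_add_right scaleC_scaleC mult.commute)
    obtain F where F: "F \<subseteq> ?V" "cvec.independent F" "?V \<subseteq> cvec.span F"
      using cvec.maximal_independent_subset[of ?V] by blast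
    have "F \<subseteq> {v. Y \<omega> 1 v = of_int k *C v}" using F(1) by blast
    then have "F \<subseteq> cvec.span (monomials (nat k))"
      unfolding \<omega>_def weight_space by (auto split: if_splits simp: cvec.span_zero)
    then have "finite F"
      using cvec.independent_span_bound[OF finite_monomials F(2)] by blast
    moreover have "cvec.span F = ?V"
      using F V cvec.span_minimal by blast
    ultimately show ?thesis by (auto simp: weight)
  qed
  have trunc: "{v\<in>U. Vir Y w 0 v = of_int k *C v} = {0}" if "k < 0" for k :: int
    using that weight_space[of h k] sub unfolding weight \<omega>_def by (auto simp: cvec.subspace_0)
  have "vertex_operator_subalgebra Y vacuum U w"
    unfolding vertex_operator_subalgebra_def
    using sub vac closed w virasoro derivative spanned fin trunc by blast
  then show ?thesis
    using agree unfolding Sc_def w_def P_def \<omega>_def by blast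
qed

lemma semiconformal_iff_projection:
  "w \<in> Sc Y vacuum (conformal_vector B h) \<longleftrightarrow>
     (\<exists>S. regular_subspace S \<and> w = quad (proj S) (proj S h))"
  using semiconformal_imp_equations equations_imp_projection projection_semiconformal by metis

lemma semiconformal_iff_equations:
  "w \<in> Sc Y vacuum (conformal_vector B h) \<longleftrightarrow>
     Y (conformal_vector B h) 1 w = 2 *C w \<and> Y (conformal_vector B h) 2 w = 0 \<and> Y w 1 w = 2 *C w"
  using semiconformal_imp_equations equations_imp_projection projection_semiconformal by metis

text \<open>
  The condition on \<open>L(0)\<close> is an anticommutator relation for the two projections and gives the
  inclusion. If the inclusion holds, the products of \<open>quad (proj T) (proj T h)\<close> with
  \<open>quad (proj S) (proj S h)\<close> involve \<open>proj T\<close> only through its composites with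
  \<open>proj S\<close>, which are equal to \<open>proj S\<close>.
\<close>
lemma Sc_le_iff_subset:
  assumes S: "regular_subspace S" and T: "regular_subspace T"
  shows "Sc_le Y (quad (proj S) (proj S h)) (quad (proj T) (proj T h)) \<longleftrightarrow> S \<subseteq> T"
proof
  note P = selfadjoint_proj[OF S] and Q = selfadjoint_proj[OF T]
  assume "Sc_le Y (quad (proj S) (proj S h)) (quad (proj T) (proj T h))"
  then have "quad (\<lambda>x. proj S (proj T x) + proj T (proj S x)) (2 *C proj T (proj S h))
      = quad (\<lambda>x. 2 *C proj S x) (2 *C proj S h)"
    by (simp add: Sc_le_def Vir_def quad_1_quad[OF Q P] quad_scale)
  moreover have "selfadjoint (\<lambda>x. proj S (proj T x) + proj T (proj S x))" "selfadjoint (\<lambda>x. 2 *C proj S x)"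
    using P Q by (simp_all add: selfadjoint_def form_add_left form_add_right form_scaleC_left form_scaleC_right)
  ultimately have "(\<lambda>x. proj S (proj T x) + proj T (proj S x)) = (\<lambda>x. 2 *C proj S x)"
    using quad_eqD(1) by blast
  then show "S \<subseteq> T"
    using proj_anticommutator[OF S T] by (simp add: fun_eq_iff)
next
  note P = selfadjoint_proj[OF S] and Q = selfadjoint_proj[OF T]
  assume "S \<subseteq> T"
  then have PQ: "proj S (proj T x) = proj S x" and QP: "proj T (proj S x) = proj S x" for x
    using proj_comp_subset[OF S T] proj_subset[OF S T] by blast+
  have form: "form (proj S h) (proj T h) = form (proj S h) (proj S h)"
    using selfadjointD[OF P, of h "proj T h"] selfadjointD[OF P, of h "proj S h"] by (simp add: PQ proj_idem[OF S])
  have dbl: "quad (\<lambda>x. proj S x + proj S x) (2 *C proj S h) = quad (\<lambda>x. 2 *C proj S x) (2 *C proj S h)"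
    by (rule arg_cong[where f = "\<lambda>A. quad A _"]) (simp only: add_self_eq_scaleC)
  show "Sc_le Y (quad (proj S) (proj S h)) (quad (proj T) (proj T h))"
    unfolding Sc_le_def Vir_def
    by (simp add: quad_0_quad[OF Q P] quad_0_quad[OF P P] quad_1_quad[OF Q P] quad_2_quad[OF Q P]
        quad_3_quad[OF Q] quad_3_quad[OF P] quad_ge4_quad[OF Q] PQ QP proj_idem[OF S] form dbl quad_scale)
qed

lemma Reg_le_iff_subset:
  assumes S: "regular_subspace S" and T: "regular_subspace T"
  shows "Reg_le (S, proj S h) (T, proj T h) \<longleftrightarrow> S \<subseteq> T"
  using proj_comp_subset[OF S T] proj_subset[OF S T] by (auto simp: Reg_le_def)

text \<open>
  The subspace is the range of the operator of \<open>w\<close>, described through \<open>w\<close> alone so that it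
  is visibly compatible with automorphisms.
\<close>
definition regular_pair :: "'a \<Rightarrow> 'a heis \<Rightarrow> 'a set \<times> 'a" where
  "regular_pair h w = (let S = {u. Y w 1 (emb u) = emb u} in (S, proj S h))"

lemma regular_pair_quad:
  assumes "regular_subspace S"
  shows "regular_pair h (quad (proj S) (proj S h)) = (S, proj S h)"
  by (simp add: regular_pair_def quad_emb selfadjoint_proj assms proj_fixes_iff)

lemma bij_regular_pair:
  "bij_betw (regular_pair h) (Sc Y vacuum (conformal_vector B h)) (Reg h)"
proof (rule bij_betw_byWitness[where f' = "\<lambda>(S, a). quad (proj S) a"])
  show "\<forall>w\<in>Sc Y vacuum (conformal_vector B h). (case regular_pair h w of (S, a) \<Rightarrow> quad (proj S) a) = w"
    unfolding semiconformal_iff_projection Ball_def by (metis regular_pair_quad case_prod_conv)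
  show "\<forall>p\<in>Reg h. regular_pair h (case p of (S, a) \<Rightarrow> quad (proj S) a) = p"
    by (auto simp: Reg_def regular_pair_quad)
  show "regular_pair h ` Sc Y vacuum (conformal_vector B h) \<subseteq> Reg h"
  proof (rule image_subsetI)
    fix w assume "w \<in> Sc Y vacuum (conformal_vector B h)"
    then obtain S where "regular_subspace S" "w = quad (proj S) (proj S h)"
      unfolding semiconformal_iff_projection by blast
    then show "regular_pair h w \<in> Reg h" by (simp add: regular_pair_quad Reg_def)
  qed
  show "(\<lambda>(S, a). quad (proj S) a) ` Reg h \<subseteq> Sc Y vacuum (conformal_vector B h)"
    by (auto simp: Reg_def projection_semiconformal)
qed

section \<open>Automorphisms\<close>

text \<open>An automorphism preserves the vectors of weight one, since it fixes the conformal vector.\<close>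
lemma Aut_act_h:
  assumes "\<sigma> \<in> Aut Y vacuum (conformal_vector B h)"
  shows "\<sigma> (emb u) = emb (act_h \<sigma> u)"
proof -
  have \<sigma>: "\<sigma> (Y x n v) = Y (\<sigma> x) n (\<sigma> v)" "\<sigma> (conformal_vector B h) = conformal_vector B h" for x n v
    using assms by (auto simp: Aut_def)
  have "Y (conformal_vector B h) 1 (emb u) = emb u"
    by (simp add: conformal_vector_quad quad_emb selfadjoint_id)
  then have "Y (conformal_vector B h) 1 (\<sigma> (emb u)) = \<sigma> (emb u)"
    by (metis \<sigma>)
  then obtain a where "\<sigma> (emb u) = emb a" by (rule weight_one)
  then show ?thesis by (simp add: act_h_def inv_f_f[OF inj_emb])
qed

lemma Aut_inverse:
  assumes "\<sigma> \<in> Aut Y vacuum \<omega>"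
  shows "inv \<sigma> \<in> Aut Y vacuum \<omega>"
proof -
  have \<sigma>: "Vector_Spaces.linear scaleC scaleC \<sigma>" "bij \<sigma>" "\<sigma> vacuum = vacuum" "\<sigma> \<omega> = \<omega>"
    "\<And>x n v. \<sigma> (Y x n v) = Y (\<sigma> x) n (\<sigma> v)"
    using assms by (auto simp: Aut_def)
  interpret L: Vector_Spaces.linear scaleC scaleC \<sigma> by (rule \<sigma>(1))
  have inv: "\<sigma> (inv \<sigma> x) = x" "inv \<sigma> (\<sigma> x) = x" for x
    using \<sigma>(2) by (simp_all add: bij_is_surj surj_f_inv_f bij_is_inj inv_f_f)
  have "Vector_Spaces.linear scaleC scaleC (inv \<sigma>)"
    by unfold_locales (metis L.add inv, metis L.scale inv)
  then show ?thesis
    unfolding Aut_def using \<sigma> inv by (auto simp: bij_imp_bij_inv) (metis inv \<sigma>)+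
qed

text \<open>
  Each property is read off from a product that the automorphism preserves: the form from
  \<open>u(1) v\<close>, and \<open>h\<close> from \<open>\<omega>\<^sub>2 u = -2 (u, h) \<one>\<close>.
\<close>
lemma act_h_isometry:
  assumes "\<sigma> \<in> Aut Y vacuum (conformal_vector B h)"
  shows "bij (act_h \<sigma>)" "form (act_h \<sigma> u) (act_h \<sigma> v) = form u v" "act_h \<sigma> h = h"
    "act_h \<sigma> (u - v) = act_h \<sigma> u - act_h \<sigma> v"
proof -
  have \<sigma>: "Vector_Spaces.linear scaleC scaleC \<sigma>" "bij \<sigma>" "\<sigma> vacuum = vacuum"
    "\<sigma> (conformal_vector B h) = conformal_vector B h"
    "\<And>x n v. \<sigma> (Y x n v) = Y (\<sigma> x) n (\<sigma> v)"
    using assms by (auto simp: Aut_def)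
  interpret L: Vector_Spaces.linear scaleC scaleC \<sigma> by (rule \<sigma>(1))
  note emb = Aut_act_h[OF assms]
  have "emb (act_h \<sigma> (u - v) + act_h \<sigma> v) = emb (act_h \<sigma> u)" for u v
    using L.add[of "emb (u - v)" "emb v"] by (simp add: emb_add emb flip: emb) (simp flip: emb_add emb)
  then show "act_h \<sigma> (u - v) = act_h \<sigma> u - act_h \<sigma> v" by (simp add: algebra_simps)
  show form: "form (act_h \<sigma> u) (act_h \<sigma> v) = form u v" for u v
  proof -
    have "form u v *C vacuum = \<sigma> (Y (emb u) 1 (emb v))"
      using L.scale[of "form u v" vacuum] by (simp add: Y_emb mode_emb \<sigma>(3))
    also have "\<dots> = form (act_h \<sigma> u) (act_h \<sigma> v) *C vacuum"
      unfolding \<sigma>(5) emb by (simp add: Y_emb mode_emb)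
    finally show ?thesis using vacuum_nonzero by (metis cvec.scale_cancel_right)
  qed
  show bij: "bij (act_h \<sigma>)"
  proof (rule o_bij)
    have "emb (act_h (inv \<sigma>) (act_h \<sigma> x)) = emb x" "emb (act_h \<sigma> (act_h (inv \<sigma>) x)) = emb x" for x
      using \<sigma>(2) by (simp_all add: bij_is_surj surj_f_inv_f bij_is_inj inv_f_f
          flip: emb Aut_act_h[OF Aut_inverse[OF assms]])
    then show "act_h (inv \<sigma>) \<circ> act_h \<sigma> = id" "act_h \<sigma> \<circ> act_h (inv \<sigma>) = id"
      by (simp_all add: fun_eq_iff)
  qed
  show "act_h \<sigma> h = h"
  proof (rule form_eqI)
    fix y
    obtain x where y: "y = act_h \<sigma> x" using bij by (metis bij_pointE)
    have *: "Y (conformal_vector B h) 2 (emb u) = (- 2 * form u h) *C vacuum" for u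
      by (simp add: conformal_vector_quad quad_emb selfadjoint_id)
    have "(- 2 * form x h) *C vacuum = \<sigma> (Y (conformal_vector B h) 2 (emb x))"
      unfolding * L.scale \<sigma>(3) ..
    also have "\<dots> = (- 2 * form y h) *C vacuum"
      unfolding \<sigma>(5) unfolding \<sigma>(4) emb * y ..
    finally have "- 2 * form x h = - 2 * form y h"
      using vacuum_nonzero by (metis cvec.scale_cancel_right)
    then show "form (act_h \<sigma> h) y = form h y"
      using form[of h x] by (simp add: y form_sym)
  qed
qed

lemma regular_pair_equivariant:
  assumes \<sigma>: "\<sigma> \<in> Aut Y vacuum (conformal_vector B h)"
    and w: "w \<in> Sc Y vacuum (conformal_vector B h)"
  shows "\<sigma> w \<in> Sc Y vacuum (conformal_vector B h)"
    and "regular_pair h (\<sigma> w) = act_Reg \<sigma> (regular_pair h w)"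
proof -
  have hom: "Vector_Spaces.linear scaleC scaleC \<sigma>"
    "\<sigma> (conformal_vector B h) = conformal_vector B h" "bij \<sigma>"
    "\<And>x n v. \<sigma> (Y x n v) = Y (\<sigma> x) n (\<sigma> v)"
    using \<sigma> by (auto simp: Aut_def)
  interpret L: Vector_Spaces.linear scaleC scaleC \<sigma> by (rule hom(1))
  show \<sigma>w: "\<sigma> w \<in> Sc Y vacuum (conformal_vector B h)"
    using w unfolding semiconformal_iff_equations by (metis hom L.scale L.zero)
  let ?s = "act_h \<sigma>"
  note iso = act_h_isometry[OF \<sigma>]
  obtain S where S: "regular_subspace S" "w = quad (proj S) (proj S h)"
    using w semiconformal_iff_projection by blast
  obtain T where T: "regular_subspace T" "\<sigma> w = quad (proj T) (proj T h)"
    using \<sigma>w semiconformal_iff_projection by blast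
  have mem: "?s u \<in> T \<longleftrightarrow> u \<in> S" for u
  proof -
    have "?s u \<in> T \<longleftrightarrow> Y (\<sigma> w) 1 (\<sigma> (emb u)) = \<sigma> (emb u)"
      by (simp add: Aut_act_h[OF \<sigma>] T(2) quad_emb selfadjoint_proj[OF T(1)] proj_fixes_iff[OF T(1)])
    also have "\<dots> \<longleftrightarrow> Y w 1 (emb u) = emb u"
      using hom(3) by (simp flip: hom(4) add: bij_is_inj inj_eq)
    also have "\<dots> \<longleftrightarrow> u \<in> S"
      by (simp add: S(2) quad_emb selfadjoint_proj[OF S(1)] proj_fixes_iff[OF S(1)])
    finally show ?thesis .
  qed
  have T_eq: "T = ?s ` S"
    using mem iso(1) by (auto simp: image_iff) (metis bij_pointE mem)
  have "proj T h = ?s (proj S h)"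
  proof (rule proj_eqI[OF T(1)])
    show "?s (proj S h) \<in> T" by (simp add: mem proj_in[OF S(1)])
    fix y assume "y \<in> T"
    then obtain x where "x \<in> S" "y = ?s x" using T_eq by blast
    then have "form (?s h - ?s (proj S h)) y = 0"
      using proj_orthogonal[OF S(1)] by (simp flip: iso(4) add: iso(2))
    then show "form (h - ?s (proj S h)) y = 0" by (simp add: iso(3))
  qed
  then show "regular_pair h (\<sigma> w) = act_Reg \<sigma> (regular_pair h w)"
    unfolding T(2) unfolding S(2) regular_pair_quad[OF S(1)] regular_pair_quad[OF T(1)]
    by (simp add: act_Reg_def T_eq)
qed

section \<open>Chains\<close>

lemma Sc_less_iff:
  assumes "regular_subspace S" "regular_subspace T"
  shows "Sc_less Y (quad (proj S) (proj S h)) (quad (proj T) (proj T h)) \<longleftrightarrow> S \<subset> T"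
proof -
  have "quad (proj S) (proj S h) = quad (proj T) (proj T h) \<longleftrightarrow> S = T"
    using regular_pair_quad[OF assms(1), of h] regular_pair_quad[OF assms(2), of h] by (metis fst_conv)
  then show ?thesis using Sc_le_iff_subset[OF assms] by (auto simp: Sc_less_def)
qed

lemma maximal_chain:
  "\<exists>w :: nat \<Rightarrow> 'a heis.
     (\<forall>i\<le>card B. w i \<in> Sc Y vacuum (conformal_vector B h)) \<and>
     w 0 = 0 \<and> w (card B) = conformal_vector B h \<and>
     (\<forall>i<card B. Sc_less Y (w i) (w (Suc i)))"
proof -
  obtain e where e: "bij_betw e {0..<card B} B"
    using ex_bij_betw_nat_finite[OF orthonormal_basis_finite[OF onb]] by blast
  define S where "S i = cvec.span (e ` {0..<i})" for i
  have sub: "e ` {0..<i} \<subseteq> B" if "i \<le> card B" for i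
    using e that by (auto simp: bij_betw_def)
  have reg: "regular_subspace (S i)" if "i \<le> card B" for i
    unfolding S_def by (rule regular_subspace_span[OF onb sub[OF that]])
  define w where "w i = quad (proj (S i)) (proj (S i) h)" for i
  have "S i \<subset> S (Suc i)" if "i < card B" for i
  proof
    show "S i \<subseteq> S (Suc i)" unfolding S_def by (intro cvec.span_mono image_mono) auto
    have inj: "inj_on e {0..<card B}" using e by (simp add: bij_betw_def)
    have "e i \<notin> e ` {0..<i}"
      using inj that by (fastforce dest: inj_onD)
    moreover have "cvec.independent (insert (e i) (e ` {0..<i}))"
    proof (rule cvec.independent_mono)
      show "cvec.independent B" using onb unfolding orthonormal_basis_def by blast
      show "insert (e i) (e ` {0..<i}) \<subseteq> B"
        using sub[of "Suc i"] that by (simp add: atLeast0_lessThan_Suc)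
    qed
    ultimately have "e i \<notin> S i"
      unfolding S_def by (simp add: cvec.independent_insert)
    moreover have "e i \<in> S (Suc i)" unfolding S_def by (rule cvec.span_base) auto
    ultimately show "S i \<noteq> S (Suc i)" by blast
  qed
  then have less: "\<forall>i<card B. Sc_less Y (w i) (w (Suc i))"
    unfolding w_def by (auto simp: Sc_less_iff reg)
  have "proj (S 0) = (\<lambda>_. 0)"
    using proj_in[OF reg[of 0]] by (auto simp: S_def fun_eq_iff)
  then have "w 0 = 0" by (simp add: w_def quad_zero)
  moreover have "w (card B) = conformal_vector B h"
  proof -
    have "S (card B) = UNIV"
      using e onb by (simp add: S_def bij_betw_def orthonormal_basis_def)
    then have "proj (S (card B)) = (\<lambda>x. x)"
      using proj_fixes_iff[OF reg[of "card B"]] by auto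
    then show ?thesis by (simp add: w_def conformal_vector_quad)
  qed
  moreover have "\<forall>i\<le>card B. w i \<in> Sc Y vacuum (conformal_vector B h)"
    using projection_semiconformal[OF reg] by (simp add: w_def)
  ultimately show ?thesis using less by blast
qed

lemma chain_length:
  assumes Sc: "\<And>i. i \<le> m \<Longrightarrow> w i \<in> Sc Y vacuum (conformal_vector B h)"
    and less: "\<And>i. i < m \<Longrightarrow> Sc_less Y (w i) (w (Suc i))"
  shows "m \<le> card B"
proof -
  have "\<forall>i. \<exists>S. i \<le> m \<longrightarrow> regular_subspace S \<and> w i = quad (proj S) (proj S h)"
    using Sc semiconformal_iff_projection by blast
  then obtain S where S: "\<And>i. i \<le> m \<Longrightarrow> regular_subspace (S i)"
      "\<And>i. i \<le> m \<Longrightarrow> w i = quad (proj (S i)) (proj (S i) h)"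
    by metis
  have "S i \<subset> S (Suc i)" if "i < m" for i
    using less[OF that] that S[of i] S[of "Suc i"] Sc_less_iff[of "S i" "S (Suc i)" h] by simp
  then show ?thesis
    unfolding orthonormal_basis_card[OF onb]
    by (intro subspace_chain_length[of m S] regular_subspace_subspace S(1))
qed

end

section \<open>The classification\<close>
theorem theorem1p3:
  fixes h :: "'a::complex_quadratic_space"
    and B :: "'a set"
    and Y :: "'a heis \<Rightarrow> int \<Rightarrow> 'a heis \<Rightarrow> 'a heis"
    and d :: nat
  assumes "cvec.dim (UNIV :: 'a set) = d"
    and "heisenberg_vertex_algebra Y"
    and "orthonormal_basis B"
  shows "(\<exists>f. bij_betw f (Sc Y vacuum (conformal_vector B h)) (Reg h) \<and>
            (\<forall>w1 \<in> Sc Y vacuum (conformal_vector B h).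
               \<forall>w2 \<in> Sc Y vacuum (conformal_vector B h).
                 Sc_le Y w1 w2 \<longleftrightarrow> Reg_le (f w1) (f w2)) \<and>
            (\<forall>\<sigma> \<in> Aut Y vacuum (conformal_vector B h).
               \<forall>w \<in> Sc Y vacuum (conformal_vector B h).
                 \<sigma> w \<in> Sc Y vacuum (conformal_vector B h) \<and>
                 f (\<sigma> w) = act_Reg \<sigma> (f w))) \<and>
         (\<exists>w :: nat \<Rightarrow> 'a heis.
            (\<forall>i\<le>d. w i \<in> Sc Y vacuum (conformal_vector B h)) \<and>
            w 0 = 0 \<and> w d = conformal_vector B h \<and>
            (\<forall>i<d. Sc_less Y (w i) (w (Suc i)))) \<and>
         (\<forall>(m::nat) (w :: nat \<Rightarrow> 'a heis).
            (\<forall>i\<le>m. w i \<in> Sc Y vacuum (conformal_vector B h)) \<longrightarrow>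
            (\<forall>i<m. Sc_less Y (w i) (w (Suc i))) \<longrightarrow> m \<le> d)"
proof -
  interpret heisenberg Y B
    by unfold_locales (rule assms(2), rule assms(3))
  have d: "d = card B"
    using assms(1) orthonormal_basis_card[OF onb] by simp
  have order: "Sc_le Y w1 w2 \<longleftrightarrow> Reg_le (regular_pair h w1) (regular_pair h w2)"
    if w: "w1 \<in> Sc Y vacuum (conformal_vector B h)" "w2 \<in> Sc Y vacuum (conformal_vector B h)"
    for w1 w2
  proof -
    obtain S T where "regular_subspace S" "w1 = quad (proj S) (proj S h)"
      "regular_subspace T" "w2 = quad (proj T) (proj T h)"
      using w semiconformal_iff_projection by blast
    then show ?thesis
      by (simp add: regular_pair_quad Sc_le_iff_subset Reg_le_iff_subset)
  qed
  show ?thesis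
    unfolding d
  proof (intro conjI[OF exI[of _ "regular_pair h"]] conjI ballI allI impI)
    show "bij_betw (regular_pair h) (Sc Y vacuum (conformal_vector B h)) (Reg h)"
      by (rule bij_regular_pair)
    show "Sc_le Y w1 w2 \<longleftrightarrow> Reg_le (regular_pair h w1) (regular_pair h w2)"
      if "w1 \<in> Sc Y vacuum (conformal_vector B h)" "w2 \<in> Sc Y vacuum (conformal_vector B h)" for w1 w2
      using that by (rule order)
    show "\<sigma> w \<in> Sc Y vacuum (conformal_vector B h)"
      and "regular_pair h (\<sigma> w) = act_Reg \<sigma> (regular_pair h w)"
      if "\<sigma> \<in> Aut Y vacuum (conformal_vector B h)" "w \<in> Sc Y vacuum (conformal_vector B h)" for \<sigma> w
      using that by (rule regular_pair_equivariant)+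
    show "m \<le> card B"
      if "\<forall>i\<le>m. w i \<in> Sc Y vacuum (conformal_vector B h)" "\<forall>i<m. Sc_less Y (w i) (w (Suc i))" for m w
      by (rule chain_length) (use that in blast)+
  qed (rule maximal_chain)
qed

end
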